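(* Let $\mathsf{T}$ and $\mathsf{S}$ be locally small categories with $\mathsf{S}$ well-powered, let $\mathcal{I}\colon\mathsf{T}\to\mathsf{S}$ be a functor and let $\triangle$ be an object of $\mathsf{T}$. Suppose that (1) $\mathsf{S}$ has equalisers of pairs of parallel arrows and intersections of arbitrary families of subobjects; (2) $\mathcal{I}$ preserves all existing powers of $\triangle$; (3) $\triangle$ is an $\mathcal{I}$-coseparator. Then, for the categories $\mathsf{D}$, $\mathsf{Q}$ and the functors $\mathcal{C},\mathcal{V}$ defined in the context, the functor $\mathcal{C}\colon\mathsf{D}\to\mathsf{Q}^{\rm op}$ is left adjoint to the functor $\mathcal{V}\colon\mathsf{Q}^{\rm op}\to\mathsf{D}$; in symbols, $\mathcal{C}\dashv\mathcal{V}$.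
   Context: Well-powered: each object of $\mathsf{S}$ has a small poset of subobjects. $\mathrm{Sub}\,\mathcal{I}(t)$ is the poset of subobjects $s\colon\mathrm{dom}\,s\to\mathcal{I}(t)$ in $\mathsf{S}$. Preservation of existing powers of $\triangle$: whenever $J$ is a set and the power $\triangle^J$ exists in $\mathsf{T}$, $\mathcal{I}(\triangle^J)\cong\mathcal{I}(\triangle)^J$ (with projections the images of the projections). $\mathcal{I}$-coseparator: for every object $t$ of $\mathsf{T}$ and every pair of distinct $\mathsf{S}$-arrows $g_1\neq g_2\colon y\to\mathcal{I}(t)$ there is a $\mathsf{T}$-arrow $f\colon t\to\triangle$ with $\mathcal{I}(f)\circ g_1\neq\mathcal{I}(f)\circ g_2$. Operators: for $s\in\mathrm{Sub}\,\mathcal{I}(t)$, $\mathbb{C}(s):=\{(p,q)\in\hom_{\mathsf{T}}(t,\triangle)^2\mid \mathcal{I}(p)\circ s=\mathcal{I}(q)\circ s\}$. For a relation $R\subseteq\hom_{\mathsf{T}}(t,\triangle)^2$, $\mathbb{V}(R):=\bigwedge_{(p,q)\in R}\mathrm{Eq}(\mathcal{I}(p),\mathcal{I}(q))$, the intersection of the subobjects of $\mathcal{I}(t)$ given by the equalisers of $\mathcal{I}(p),\mathcal{I}(q)\colon\mathcal{I}(t)\rightrightarrows\mathcal{I}(\triangle)$. $\triangle$-congruence: an equivalence relation $R$ on $\hom_{\mathsf{T}}(t,\triangle)$ such that, for any set $J$ for which $\triangle^J$ exists in $\mathsf{T}$, any $g\colon\triangle^J\to\triangle$ and any family $(p_j,q_j)_{j\in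 J}$ of pairs in $R$, one has $(g\circ\langle p_j\rangle_{j\in J},\,g\circ\langle q_j\rangle_{j\in J})\in R$, where $\langle p_j\rangle_{j\in J}\colon t\to\triangle^J$ is the arrow with components $p_j$. Each $\mathbb{C}(s)$ is a $\triangle$-congruence. Category $\mathsf{Q}$: objects are quotient sets $\hom_{\mathsf{T}}(t,\triangle)/R$, also denoted by pairs $(t,R)$, with $t$ an object of $\mathsf{T}$ and $R$ a $\triangle$-congruence on $\hom_{\mathsf{T}}(t,\triangle)$. A $\mathsf{Q}$-arrow $(t',R')\to(t,R)$ (i.e. a $\mathsf{Q}^{\rm op}$-arrow $(t,R)\to(t',R')$) is a function $g\colon\hom_{\mathsf{T}}(t',\triangle)/R'\to\hom_{\mathsf{T}}(t,\triangle)/R$ for which there is a $\mathsf{T}$-arrow $f\colon t\to t'$ such that $(p',q')\in R'$ implies $(p'\circ f,q'\circ f)\in R$, and $g$ sends the class of $p'$ to the class of $p'\circ f$; one says $f$ induces $g$. Category $\mathsf{D}$: objects are pairs $(t,s)$ with $t$ an object of $\mathsf{T}$ and $s\in\mathrm{Sub}\,\mathcal{I}(t)$. A $\mathsf{D}$-arrow $(t,s)\to(t',s')$ is an $\mathsf{S}$-arrow $g\colon\mathrm{dom}\,s\to\mathrm{dom}\,s'$ for which there is a $\mathsf{T}$-arrow $f\colon t\to t'$ with $\mathcal{I}(f)\circ s=s'\circ g$; one says $f$ induces $g$. Functors: $\mathcal{C}(t,s):=\hom_{\mathsf{T}}(t,\triangle)/\mathbb{C}(s)$, i.e. the object $(t,\mathbb{C}(s))$,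 and $\mathcal{C}$ sends a $\mathsf{D}$-arrow induced by $f\colon t\to t'$ to the $\mathsf{Q}^{\rm op}$-arrow induced by $f$. $\mathcal{V}(t,R):=(t,\mathbb{V}(R))$, and $\mathcal{V}$ sends a $\mathsf{Q}^{\rm op}$-arrow induced by $f\colon t\to t'$ to the $\mathsf{D}$-arrow induced by $f$. (Both are well defined under the assumptions.) *)

theory Defs
  imports "HOL-Library.FuncSet" "HOL-Library.Equipollence"
begin

section \<open>Smallness\<close>

text \<open>
  The type \<open>'u\<close> plays the role of the class of all sets, and a collection is a (small) set
  iff it is strictly smaller than \<open>'u\<close> (limitation of size). The type \<open>'u\<close> is arbitrary: it
  may be taken to be a Grothendieck universe, or larger than every collection that occurs.
\<close>

definition small :: "'u itself \<Rightarrow> 'x set \<Rightarrow> bool" where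
  "small U A \<longleftrightarrow> A \<prec> (UNIV :: 'u set)"


section \<open>Categories, functors, adjunctions\<close>

record ('o, 'a) cat =
  Ob   :: "'o set"
  Arr  :: "'a set"
  Dom  :: "'a \<Rightarrow> 'o"
  Cod  :: "'a \<Rightarrow> 'o"
  Id   :: "'o \<Rightarrow> 'a"
  Comp :: "'a \<Rightarrow> 'a \<Rightarrow> 'a" (infixl "\<odot>\<index>" 70)

definition Hom :: "('o, 'a) cat \<Rightarrow> 'o \<Rightarrow> 'o \<Rightarrow> 'a set" where
  "Hom C x y = {f \<in> Arr C. Dom C f = x \<and> Cod C f = y}"

definition category :: "('o, 'a) cat \<Rightarrow> bool" where
  "category C \<longleftrightarrow>
     (\<forall>f\<in>Arr C. Dom C f \<in> Ob C \<and> Cod C f \<in> Ob C) \<and>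
     (\<forall>x\<in>Ob C. Id C x \<in> Hom C x x) \<and>
     (\<forall>f\<in>Arr C. \<forall>g\<in>Arr C. Dom C g = Cod C f \<longrightarrow> g \<odot>\<^bsub>C\<^esub> f \<in> Hom C (Dom C f) (Cod C g)) \<and>
     (\<forall>f\<in>Arr C. f \<odot>\<^bsub>C\<^esub> Id C (Dom C f) = f \<and> Id C (Cod C f) \<odot>\<^bsub>C\<^esub> f = f) \<and>
     (\<forall>f\<in>Arr C. \<forall>g\<in>Arr C. \<forall>h\<in>Arr C. Dom C g = Cod C f \<longrightarrow> Dom C h = Cod C g \<longrightarrow>
        h \<odot>\<^bsub>C\<^esub> (g \<odot>\<^bsub>C\<^esub> f) = (h \<odot>\<^bsub>C\<^esub> g) \<odot>\<^bsub>C\<^esub> f)"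

definition locally_small :: "'u itself \<Rightarrow> ('o, 'a) cat \<Rightarrow> bool" where
  "locally_small U C \<longleftrightarrow> (\<forall>x\<in>Ob C. \<forall>y\<in>Ob C. small U (Hom C x y))"

definition opposite :: "('o, 'a) cat \<Rightarrow> ('o, 'a) cat" where
  "opposite C = \<lparr>Ob = Ob C, Arr = Arr C, Dom = Cod C, Cod = Dom C, Id = Id C,
                 Comp = (\<lambda>g f. f \<odot>\<^bsub>C\<^esub> g)\<rparr>"

record ('o1, 'a1, 'o2, 'a2) fctr =
  omap :: "'o1 \<Rightarrow> 'o2"
  amap :: "'a1 \<Rightarrow> 'a2"

definition is_functor ::
  "('o1, 'a1) cat \<Rightarrow> ('o2, 'a2) cat \<Rightarrow> ('o1, 'a1, 'o2, 'a2) fctr \<Rightarrow> bool" where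
  "is_functor A B F \<longleftrightarrow> category A \<and> category B \<and>
     (\<forall>x\<in>Ob A. omap F x \<in> Ob B) \<and>
     (\<forall>f\<in>Arr A. amap F f \<in> Hom B (omap F (Dom A f)) (omap F (Cod A f))) \<and>
     (\<forall>x\<in>Ob A. amap F (Id A x) = Id B (omap F x)) \<and>
     (\<forall>f\<in>Arr A. \<forall>g\<in>Arr A. Dom A g = Cod A f \<longrightarrow>
        amap F (g \<odot>\<^bsub>A\<^esub> f) = amap F g \<odot>\<^bsub>B\<^esub> amap F f)"

text \<open>\<open>left_adjoint A B F G\<close>: the functor \<open>F : A \<rightarrow> B\<close> is left adjoint to \<open>G : B \<rightarrow> A\<close>.\<close>

definition left_adjoint ::
  "('o1, 'a1) cat \<Rightarrow> ('o2, 'a2) cat \<Rightarrow> ('o1, 'a1, 'o2, 'a2) fctr \<Rightarrow>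
     ('o2, 'a2, 'o1, 'a1) fctr \<Rightarrow> bool" where
  "left_adjoint A B F G \<longleftrightarrow> is_functor A B F \<and> is_functor B A G \<and>
     (\<exists>\<phi> :: 'o1 \<Rightarrow> 'o2 \<Rightarrow> 'a2 \<Rightarrow> 'a1.
        (\<forall>x\<in>Ob A. \<forall>y\<in>Ob B. bij_betw (\<phi> x y) (Hom B (omap F x) y) (Hom A x (omap G y))) \<and>
        (\<forall>x\<in>Ob A. \<forall>x'\<in>Ob A. \<forall>y\<in>Ob B. \<forall>y'\<in>Ob B.
           \<forall>f\<in>Hom A x' x. \<forall>g\<in>Hom B y y'. \<forall>h\<in>Hom B (omap F x) y.
             \<phi> x' y' (g \<odot>\<^bsub>B\<^esub> h \<odot>\<^bsub>B\<^esub> amap F f) = amap G g \<odot>\<^bsub>A\<^esub> \<phi> x y h \<odot>\<^bsub>A\<^esub> f))"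


section \<open>Subobjects, equalisers, intersections\<close>

definition mono_arr :: "('o, 'a) cat \<Rightarrow> 'a \<Rightarrow> bool" where
  "mono_arr C m \<longleftrightarrow> m \<in> Arr C \<and>
     (\<forall>f\<in>Arr C. \<forall>g\<in>Arr C. Dom C f = Dom C g \<longrightarrow> Cod C f = Dom C m \<longrightarrow> Cod C g = Dom C m \<longrightarrow>
        m \<odot>\<^bsub>C\<^esub> f = m \<odot>\<^bsub>C\<^esub> g \<longrightarrow> f = g)"

definition factors_through :: "('o, 'a) cat \<Rightarrow> 'a \<Rightarrow> 'a \<Rightarrow> bool" where
  "factors_through C f m \<longleftrightarrow> (\<exists>h\<in>Hom C (Dom C f) (Dom C m). m \<odot>\<^bsub>C\<^esub> h = f)"

text \<open>
  A subobject of \<open>x\<close> is an equivalence class of monomorphisms into \<open>x\<close>. It is represented by a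
  monomorphism chosen once and for all from the class, so that \<open>Sub C x\<close>, ordered by
  \<open>factors_through C\<close>, is a poset and every subobject has a domain.
\<close>

definition sub_rep :: "('o, 'a) cat \<Rightarrow> 'a \<Rightarrow> 'a" where
  "sub_rep C m = (SOME k. mono_arr C k \<and> Cod C k = Cod C m \<and>
                          factors_through C k m \<and> factors_through C m k)"

definition Sub :: "('o, 'a) cat \<Rightarrow> 'o \<Rightarrow> 'a set" where
  "Sub C x = sub_rep C ` {m. mono_arr C m \<and> Cod C m = x}"

definition well_powered :: "'u itself \<Rightarrow> ('o, 'a) cat \<Rightarrow> bool" where
  "well_powered U C \<longleftrightarrow> (\<forall>x\<in>Ob C. small U (Sub C x))"

definition is_equaliser :: "('o, 'a) cat \<Rightarrow> 'a \<Rightarrow> 'a \<Rightarrow> 'a \<Rightarrow> bool" where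
  "is_equaliser C f g e \<longleftrightarrow> e \<in> Arr C \<and> Cod C e = Dom C f \<and> f \<odot>\<^bsub>C\<^esub> e = g \<odot>\<^bsub>C\<^esub> e \<and>
     (\<forall>k\<in>Arr C. Cod C k = Dom C f \<longrightarrow> f \<odot>\<^bsub>C\<^esub> k = g \<odot>\<^bsub>C\<^esub> k \<longrightarrow>
        (\<exists>!h. h \<in> Hom C (Dom C k) (Dom C e) \<and> e \<odot>\<^bsub>C\<^esub> h = k))"

definition has_equalisers :: "('o, 'a) cat \<Rightarrow> bool" where
  "has_equalisers C \<longleftrightarrow>
     (\<forall>x\<in>Ob C. \<forall>y\<in>Ob C. \<forall>f\<in>Hom C x y. \<forall>g\<in>Hom C x y. \<exists>e. is_equaliser C f g e)"

definition Eq :: "('o, 'a) cat \<Rightarrow> 'a \<Rightarrow> 'a \<Rightarrow> 'a" where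
  "Eq C f g = (THE e. e \<in> Sub C (Dom C f) \<and> is_equaliser C f g e)"

text \<open>
  Intersections are limits: the universal property is required with respect to all arrows into
  \<open>x\<close>, not only with respect to monomorphisms. The intersection of the empty family is the
  largest subobject.
\<close>

definition is_intersection :: "('o, 'a) cat \<Rightarrow> 'o \<Rightarrow> 'a set \<Rightarrow> 'a \<Rightarrow> bool" where
  "is_intersection C x M m \<longleftrightarrow> mono_arr C m \<and> Cod C m = x \<and>
     (\<forall>k\<in>M. factors_through C m k) \<and>
     (\<forall>f\<in>Arr C. Cod C f = x \<longrightarrow> (\<forall>k\<in>M. factors_through C f k) \<longrightarrow> factors_through C f m)"

definition has_intersections :: "('o, 'a) cat \<Rightarrow> bool" where
  "has_intersections C \<longleftrightarrow> (\<forall>x\<in>Ob C. \<forall>M. M \<subseteq> Sub C x \<longrightarrow> (\<exists>m. is_intersection C x M m))"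

definition intersection :: "('o, 'a) cat \<Rightarrow> 'o \<Rightarrow> 'a set \<Rightarrow> 'a" where
  "intersection C x M = (THE m. m \<in> Sub C x \<and> is_intersection C x M m)"


section \<open>Powers\<close>

text \<open>\<open>is_power C d J p \<pi>\<close>: the object \<open>p\<close> with projections \<open>\<pi> j\<close> is a power of \<open>d\<close> by \<open>J\<close>.\<close>

definition is_power :: "('o, 'a) cat \<Rightarrow> 'o \<Rightarrow> 'j set \<Rightarrow> 'o \<Rightarrow> ('j \<Rightarrow> 'a) \<Rightarrow> bool" where
  "is_power C d J p \<pi> \<longleftrightarrow> p \<in> Ob C \<and> (\<forall>j\<in>J. \<pi> j \<in> Hom C p d) \<and>
     (\<forall>x\<in>Ob C. \<forall>f. (\<forall>j\<in>J. f j \<in> Hom C x d) \<longrightarrow>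
        (\<exists>!h. h \<in> Hom C x p \<and> (\<forall>j\<in>J. \<pi> j \<odot>\<^bsub>C\<^esub> h = f j)))"

definition tuple ::
  "('o, 'a) cat \<Rightarrow> 'j set \<Rightarrow> 'o \<Rightarrow> ('j \<Rightarrow> 'a) \<Rightarrow> 'o \<Rightarrow> ('j \<Rightarrow> 'a) \<Rightarrow> 'a" where
  "tuple C J p \<pi> x f = (THE h. h \<in> Hom C x p \<and> (\<forall>j\<in>J. \<pi> j \<odot>\<^bsub>C\<^esub> h = f j))"

definition preserves_powers ::
  "'u itself \<Rightarrow> ('ot, 'at) cat \<Rightarrow> ('os, 'as) cat \<Rightarrow> ('ot, 'at, 'os, 'as) fctr \<Rightarrow> 'ot \<Rightarrow> bool" where
  "preserves_powers U T S I d \<longleftrightarrow>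
     (\<forall>(J :: 'u set) p \<pi>. small U J \<longrightarrow> is_power T d J p \<pi> \<longrightarrow>
        is_power S (omap I d) J (omap I p) (\<lambda>j. amap I (\<pi> j)))"

definition coseparator ::
  "('ot, 'at) cat \<Rightarrow> ('os, 'as) cat \<Rightarrow> ('ot, 'at, 'os, 'as) fctr \<Rightarrow> 'ot \<Rightarrow> bool" where
  "coseparator T S I d \<longleftrightarrow>
     (\<forall>t\<in>Ob T. \<forall>y\<in>Ob S. \<forall>g1\<in>Hom S y (omap I t). \<forall>g2\<in>Hom S y (omap I t). g1 \<noteq> g2 \<longrightarrow>
        (\<exists>f\<in>Hom T t d. amap I f \<odot>\<^bsub>S\<^esub> g1 \<noteq> amap I f \<odot>\<^bsub>S\<^esub> g2))"


section \<open>The operators and the categories\<close>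

definition CC ::
  "('ot, 'at) cat \<Rightarrow> ('os, 'as) cat \<Rightarrow> ('ot, 'at, 'os, 'as) fctr \<Rightarrow> 'ot \<Rightarrow>
     'ot \<Rightarrow> 'as \<Rightarrow> ('at \<times> 'at) set" where
  "CC T S I d t s =
     {(p, q). p \<in> Hom T t d \<and> q \<in> Hom T t d \<and> amap I p \<odot>\<^bsub>S\<^esub> s = amap I q \<odot>\<^bsub>S\<^esub> s}"

definition VV ::
  "('os, 'as) cat \<Rightarrow> ('ot, 'at, 'os, 'as) fctr \<Rightarrow> 'ot \<Rightarrow> ('at \<times> 'at) set \<Rightarrow> 'as" where
  "VV S I t R = intersection S (omap I t) {Eq S (amap I p) (amap I q) |p q. (p, q) \<in> R}"

definition delta_congruence ::
  "'u itself \<Rightarrow> ('ot, 'at) cat \<Rightarrow> 'ot \<Rightarrow> 'ot \<Rightarrow> ('at \<times> 'at) set \<Rightarrow> bool" where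
  "delta_congruence U T d t R \<longleftrightarrow> equiv (Hom T t d) R \<and>
     (\<forall>(J :: 'u set) p \<pi>. small U J \<longrightarrow> is_power T d J p \<pi> \<longrightarrow>
        (\<forall>g\<in>Hom T p d. \<forall>P Q. (\<forall>j\<in>J. (P j, Q j) \<in> R) \<longrightarrow>
           (g \<odot>\<^bsub>T\<^esub> tuple T J p \<pi> t P, g \<odot>\<^bsub>T\<^esub> tuple T J p \<pi> t Q) \<in> R))"

text \<open>
  Arrows of the two categories are triples (domain, underlying arrow or function, codomain).
  An object \<open>(t, R)\<close> of \<open>QQ\<close> stands for the quotient set \<open>Hom T t d // R\<close>; the pair is kept
  because for empty hom-sets the quotient does not determine \<open>t\<close>. Functions between quotient
  sets are extensional, so that they are equal iff they agree on their domain.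
\<close>

type_synonym ('ot, 'as) D_ob = "'ot \<times> 'as"
type_synonym ('ot, 'as) D_arr = "('ot, 'as) D_ob \<times> 'as \<times> ('ot, 'as) D_ob"
type_synonym ('ot, 'at) Q_ob = "'ot \<times> ('at \<times> 'at) set"
type_synonym ('ot, 'at) Q_arr = "('ot, 'at) Q_ob \<times> ('at set \<Rightarrow> 'at set) \<times> ('ot, 'at) Q_ob"

definition D_objects ::
  "('ot, 'at) cat \<Rightarrow> ('os, 'as) cat \<Rightarrow> ('ot, 'at, 'os, 'as) fctr \<Rightarrow> ('ot, 'as) D_ob set" where
  "D_objects T S I = {(t, s). t \<in> Ob T \<and> s \<in> Sub S (omap I t)}"

fun D_induces ::
  "('ot, 'at) cat \<Rightarrow> ('os, 'as) cat \<Rightarrow> ('ot, 'at, 'os, 'as) fctr \<Rightarrow>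
     'at \<Rightarrow> ('ot, 'as) D_arr \<Rightarrow> bool" where
  "D_induces T S I f ((t, s), g, (t', s')) \<longleftrightarrow>
     f \<in> Hom T t t' \<and> g \<in> Hom S (Dom S s) (Dom S s') \<and> amap I f \<odot>\<^bsub>S\<^esub> s = s' \<odot>\<^bsub>S\<^esub> g"

definition DD ::
  "('ot, 'at) cat \<Rightarrow> ('os, 'as) cat \<Rightarrow> ('ot, 'at, 'os, 'as) fctr \<Rightarrow>
     (('ot, 'as) D_ob, ('ot, 'as) D_arr) cat" where
  "DD T S I =
     \<lparr>Ob = D_objects T S I,
      Arr = {(x, g, y). x \<in> D_objects T S I \<and> y \<in> D_objects T S I \<and>
                        (\<exists>f. D_induces T S I f (x, g, y))},
      Dom = (\<lambda>(x, g, y). x),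
      Cod = (\<lambda>(x, g, y). y),
      Id = (\<lambda>(t, s). ((t, s), Id S (Dom S s), (t, s))),
      Comp = (\<lambda>(y', h, z) (x, g, y). (x, h \<odot>\<^bsub>S\<^esub> g, z))\<rparr>"

definition Q_objects :: "'u itself \<Rightarrow> ('ot, 'at) cat \<Rightarrow> 'ot \<Rightarrow> ('ot, 'at) Q_ob set" where
  "Q_objects U T d = {(t, R). t \<in> Ob T \<and> delta_congruence U T d t R}"

definition Q_carrier :: "('ot, 'at) cat \<Rightarrow> 'ot \<Rightarrow> ('ot, 'at) Q_ob \<Rightarrow> 'at set set" where
  "Q_carrier T d = (\<lambda>(t, R). Hom T t d // R)"

text \<open>An arrow \<open>(t', R') \<rightarrow> (t, R)\<close> is induced by an arrow \<open>t \<rightarrow> t'\<close>, in the reverse direction.\<close>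

fun Q_induces :: "('ot, 'at) cat \<Rightarrow> 'ot \<Rightarrow> 'at \<Rightarrow> ('ot, 'at) Q_arr \<Rightarrow> bool" where
  "Q_induces T d f ((t', R'), g, (t, R)) \<longleftrightarrow>
     f \<in> Hom T t t' \<and>
     g \<in> (Hom T t' d // R') \<rightarrow>\<^sub>E (Hom T t d // R) \<and>
     (\<forall>(p', q')\<in>R'. (p' \<odot>\<^bsub>T\<^esub> f, q' \<odot>\<^bsub>T\<^esub> f) \<in> R) \<and>
     (\<forall>p'\<in>Hom T t' d. g (R' `` {p'}) = R `` {p' \<odot>\<^bsub>T\<^esub> f})"

definition QQ ::
  "'u itself \<Rightarrow> ('ot, 'at) cat \<Rightarrow> 'ot \<Rightarrow> (('ot, 'at) Q_ob, ('ot, 'at) Q_arr) cat" where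
  "QQ U T d =
     \<lparr>Ob = Q_objects U T d,
      Arr = {(x, g, y). x \<in> Q_objects U T d \<and> y \<in> Q_objects U T d \<and>
                        (\<exists>f. Q_induces T d f (x, g, y))},
      Dom = (\<lambda>(x, g, y). x),
      Cod = (\<lambda>(x, g, y). y),
      Id = (\<lambda>x. (x, restrict id (Q_carrier T d x), x)),
      Comp = (\<lambda>(y', h, z) (x, g, y). (x, compose (Q_carrier T d x) h g, z))\<rparr>"


section \<open>The functors\<close>

text \<open>
  The arrow parts use definite description: the image of an arrow \<open>\<alpha>\<close> is the one arrow, between
  the prescribed objects, that is induced by an arrow of \<open>T\<close> which also induces \<open>\<alpha>\<close>.
  An arrow \<open>x \<rightarrow> y\<close> of \<open>opposite (QQ U T d)\<close> is a triple whose first component is \<open>y\<close>.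
\<close>

definition C_ob ::
  "('ot, 'at) cat \<Rightarrow> ('os, 'as) cat \<Rightarrow> ('ot, 'at, 'os, 'as) fctr \<Rightarrow> 'ot \<Rightarrow>
     ('ot, 'as) D_ob \<Rightarrow> ('ot, 'at) Q_ob" where
  "C_ob T S I d = (\<lambda>(t, s). (t, CC T S I d t s))"

definition V_ob ::
  "('os, 'as) cat \<Rightarrow> ('ot, 'at, 'os, 'as) fctr \<Rightarrow> ('ot, 'at) Q_ob \<Rightarrow> ('ot, 'as) D_ob" where
  "V_ob S I = (\<lambda>(t, R). (t, VV S I t R))"

definition C_functor ::
  "('ot, 'at) cat \<Rightarrow> ('os, 'as) cat \<Rightarrow> ('ot, 'at, 'os, 'as) fctr \<Rightarrow> 'ot \<Rightarrow>
     (('ot, 'as) D_ob, ('ot, 'as) D_arr, ('ot, 'at) Q_ob, ('ot, 'at) Q_arr) fctr" where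
  "C_functor T S I d =
     \<lparr>omap = C_ob T S I d,
      amap = (\<lambda>(x, g, y).
        (C_ob T S I d y,
         (THE h. \<exists>f. D_induces T S I f (x, g, y) \<and>
                     Q_induces T d f (C_ob T S I d y, h, C_ob T S I d x)),
         C_ob T S I d x))\<rparr>"

definition V_functor ::
  "('ot, 'at) cat \<Rightarrow> ('os, 'as) cat \<Rightarrow> ('ot, 'at, 'os, 'as) fctr \<Rightarrow> 'ot \<Rightarrow>
     (('ot, 'at) Q_ob, ('ot, 'at) Q_arr, ('ot, 'as) D_ob, ('ot, 'as) D_arr) fctr" where
  "V_functor T S I d =
     \<lparr>omap = V_ob S I,
      amap = (\<lambda>(y, h, x).
        (V_ob S I x,
         (THE g. \<exists>f. Q_induces T d f (y, h, x) \<and>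
                     D_induces T S I f (V_ob S I x, g, V_ob S I y)),
         V_ob S I y))\<rparr>"

end

theory Submission
  imports Defs
begin

text \<open>
  For \<open>x = (t, s)\<close> in \<open>\<D>\<close>, \<open>y = (t', R)\<close> in \<open>\<Q>\<close> and \<open>f : t \<rightarrow> t'\<close>, the arrow \<open>f\<close> induces an
  arrow \<open>y \<rightarrow> (t, C(s))\<close> iff \<open>\<I>(f) \<circ> s\<close> equalises \<open>\<I>(p)\<close> and \<open>\<I>(q)\<close> for all \<open>(p, q)\<close> in \<open>R\<close>, that is,
  iff \<open>\<I>(f) \<circ> s\<close> factors through \<open>\<V>(R)\<close>, that is, iff \<open>f\<close> induces an arrow \<open>x \<rightarrow> (t', \<V>(R))\<close>.
  Moreover \<open>f\<close> and \<open>f'\<close> induce the same arrow iff \<open>\<I>(f) \<circ> s = \<I>(f') \<circ> s\<close>: on the side of \<open>\<D>\<close>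
  because \<open>\<V>(R)\<close> is monic, on the side of \<open>\<Q>\<close> because \<open>\<Delta>\<close> is an \<open>\<I>\<close>-coseparator. So matching the
  arrows induced by a common \<open>f\<close> is a bijection, and it is natural since inducing arrows compose.
\<close>

section \<open>Categories and functors\<close>

lemma HomD:
  assumes "f \<in> Hom C x y"
  shows "f \<in> Arr C" "Dom C f = x" "Cod C f = y"
  using assms by (auto simp: Hom_def)

lemma categoryI:
  assumes "\<And>f. f \<in> Arr C \<Longrightarrow> Dom C f \<in> Ob C \<and> Cod C f \<in> Ob C"
    and "\<And>x. x \<in> Ob C \<Longrightarrow> Id C x \<in> Hom C x x"
    and "\<And>f g x y z. f \<in> Hom C x y \<Longrightarrow> g \<in> Hom C y z \<Longrightarrow> g \<odot>\<^bsub>C\<^esub> f \<in> Hom C x z"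
    and "\<And>f x y. f \<in> Hom C x y \<Longrightarrow> f \<odot>\<^bsub>C\<^esub> Id C x = f \<and> Id C y \<odot>\<^bsub>C\<^esub> f = f"
    and "\<And>f g h x y z w. f \<in> Hom C x y \<Longrightarrow> g \<in> Hom C y z \<Longrightarrow> h \<in> Hom C z w \<Longrightarrow>
           h \<odot>\<^bsub>C\<^esub> (g \<odot>\<^bsub>C\<^esub> f) = (h \<odot>\<^bsub>C\<^esub> g) \<odot>\<^bsub>C\<^esub> f"
  shows "category C"
  using assms unfolding category_def Hom_def by (simp (no_asm_use)) blast

lemma Hom_Ob:
  assumes "category C" and "f \<in> Hom C x y"
  shows "x \<in> Ob C" "y \<in> Ob C"
  using assms by (auto simp: Hom_def category_def)

lemma Id_in_Hom: "category C \<Longrightarrow> x \<in> Ob C \<Longrightarrow> Id C x \<in> Hom C x x"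
  by (auto simp: category_def)

lemma Comp_in_Hom:
  "category C \<Longrightarrow> f \<in> Hom C x y \<Longrightarrow> g \<in> Hom C y z \<Longrightarrow> g \<odot>\<^bsub>C\<^esub> f \<in> Hom C x z"
  unfolding category_def Hom_def by blast

lemma Comp_Id:
  assumes "category C" and "f \<in> Hom C x y"
  shows "f \<odot>\<^bsub>C\<^esub> Id C x = f" "Id C y \<odot>\<^bsub>C\<^esub> f = f"
  using assms unfolding category_def Hom_def by blast+

lemma Comp_assoc:
  "category C \<Longrightarrow> f \<in> Hom C x y \<Longrightarrow> g \<in> Hom C y z \<Longrightarrow> h \<in> Hom C z w \<Longrightarrow>
     h \<odot>\<^bsub>C\<^esub> (g \<odot>\<^bsub>C\<^esub> f) = (h \<odot>\<^bsub>C\<^esub> g) \<odot>\<^bsub>C\<^esub> f"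
  unfolding category_def Hom_def by blast

lemma Hom_opposite [simp]: "Hom (opposite C) x y = Hom C y x"
  by (auto simp: Hom_def opposite_def)

lemma opposite_sel [simp]:
  "Ob (opposite C) = Ob C" "Id (opposite C) = Id C" "g \<odot>\<^bsub>opposite C\<^esub> f = f \<odot>\<^bsub>C\<^esub> g"
  by (auto simp: opposite_def)

lemma category_opposite:
  assumes "category C"
  shows "category (opposite C)"
proof (rule categoryI)
  fix f assume "f \<in> Arr (opposite C)"
  then show "Dom (opposite C) f \<in> Ob (opposite C) \<and> Cod (opposite C) f \<in> Ob (opposite C)"
    using assms by (auto simp: opposite_def category_def)
qed (auto simp: Id_in_Hom Comp_Id Comp_assoc assms intro: Comp_in_Hom)

lemma is_functorI:
  assumes "category A" and "category B"
    and "\<And>x. x \<in> Ob A \<Longrightarrow> omap F x \<in> Ob B"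
    and "\<And>f x y. f \<in> Hom A x y \<Longrightarrow> amap F f \<in> Hom B (omap F x) (omap F y)"
    and "\<And>x. x \<in> Ob A \<Longrightarrow> amap F (Id A x) = Id B (omap F x)"
    and "\<And>f g x y z. f \<in> Hom A x y \<Longrightarrow> g \<in> Hom A y z \<Longrightarrow>
           amap F (g \<odot>\<^bsub>A\<^esub> f) = amap F g \<odot>\<^bsub>B\<^esub> amap F f"
  shows "is_functor A B F"
proof -
  \<comment> \<open>Every arrow lies in the hom-set of its own endpoints, which turns the
    assumptions on hom-sets into the axioms stated with \<open>Arr\<close>, \<open>Dom\<close> and
    \<open>Cod\<close>.\<close>
  have "f \<in> Hom A (Dom A f) (Cod A f)" if "f \<in> Arr A" for f
    using that by (simp add: Hom_def)
  moreover have "g \<in> Hom A (Cod A f) (Cod A g)" if "g \<in> Arr A" "Dom A g = Cod A f" for f g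
    using that by (simp add: Hom_def)
  ultimately show ?thesis
    using assms unfolding is_functor_def by blast
qed

lemma functor_Hom: "is_functor A B F \<Longrightarrow> f \<in> Hom A x y \<Longrightarrow> amap F f \<in> Hom B (omap F x) (omap F y)"
  unfolding is_functor_def Hom_def by blast

lemma functor_Ob: "is_functor A B F \<Longrightarrow> x \<in> Ob A \<Longrightarrow> omap F x \<in> Ob B"
  unfolding is_functor_def by blast

lemma functor_Id: "is_functor A B F \<Longrightarrow> x \<in> Ob A \<Longrightarrow> amap F (Id A x) = Id B (omap F x)"
  unfolding is_functor_def by blast

lemma functor_Comp:
  "is_functor A B F \<Longrightarrow> f \<in> Hom A x y \<Longrightarrow> g \<in> Hom A y z \<Longrightarrow>
     amap F (g \<odot>\<^bsub>A\<^esub> f) = amap F g \<odot>\<^bsub>B\<^esub> amap F f"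
  unfolding is_functor_def Hom_def by blast

section \<open>Subobjects\<close>

lemma mono_arr_cancel:
  assumes "mono_arr C m" and "f \<in> Hom C x (Dom C m)" and "g \<in> Hom C x (Dom C m)"
    and "m \<odot>\<^bsub>C\<^esub> f = m \<odot>\<^bsub>C\<^esub> g"
  shows "f = g"
  using assms unfolding mono_arr_def Hom_def by force

lemma mono_arr_Hom: "mono_arr C m \<Longrightarrow> m \<in> Hom C (Dom C m) (Cod C m)"
  by (simp add: mono_arr_def Hom_def)

lemma factors_through_refl:
  assumes "category C" and "f \<in> Arr C"
  shows "factors_through C f f"
proof -
  have "f \<in> Hom C (Dom C f) (Cod C f)"
    using assms(2) by (simp add: Hom_def)
  then show ?thesis
    using assms(1) Comp_Id(1) Id_in_Hom Hom_Ob(1) unfolding factors_through_def by metis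
qed

lemma factors_through_trans:
  assumes "category C" and "m \<in> Arr C"
    and "factors_through C f k" and "factors_through C k m"
  shows "factors_through C f m"
proof -
  obtain h where h: "h \<in> Hom C (Dom C f) (Dom C k)" "k \<odot>\<^bsub>C\<^esub> h = f"
    using assms(3) by (auto simp: factors_through_def)
  obtain h' where h': "h' \<in> Hom C (Dom C k) (Dom C m)" "m \<odot>\<^bsub>C\<^esub> h' = k"
    using assms(4) by (auto simp: factors_through_def)
  have "m \<in> Hom C (Dom C m) (Cod C m)"
    using assms(2) by (simp add: Hom_def)
  then have "m \<odot>\<^bsub>C\<^esub> (h' \<odot>\<^bsub>C\<^esub> h) = f"
    using Comp_assoc[OF assms(1) h(1) h'(1)] h(2) h'(2) by simp
  then show ?thesis
    using Comp_in_Hom[OF assms(1) h(1) h'(1)] by (auto simp: factors_through_def)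
qed

text \<open>The choice is made from a nonempty collection: \<open>m\<close> itself qualifies, since
  an arrow factors through itself by an identity.\<close>

lemma sub_rep:
  assumes "category C" and "mono_arr C m"
  shows "mono_arr C (sub_rep C m)" "Cod C (sub_rep C m) = Cod C m"
    "factors_through C (sub_rep C m) m" "factors_through C m (sub_rep C m)"
proof -
  let ?P = "\<lambda>k. mono_arr C k \<and> Cod C k = Cod C m \<and> factors_through C k m \<and> factors_through C m k"
  have "?P m"
    using assms factors_through_refl by (auto simp: mono_arr_def)
  then have "?P (sub_rep C m)"
    unfolding sub_rep_def by (rule someI)
  then show "mono_arr C (sub_rep C m)" "Cod C (sub_rep C m) = Cod C m"
    "factors_through C (sub_rep C m) m" "factors_through C m (sub_rep C m)"
    by blast+
qed

text \<open>Mutual factorisation carries over to every comparison with a third monomorphism, so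
  \<open>m\<close> and \<open>n\<close> hand the choice operator the same predicate and receive the
  same value.\<close>

lemma sub_rep_eqI:
  assumes "category C" and "mono_arr C m" and "mono_arr C n" and "Cod C m = Cod C n"
    and "factors_through C m n" and "factors_through C n m"
  shows "sub_rep C m = sub_rep C n"
proof -
  have "factors_through C k m \<longleftrightarrow> factors_through C k n"
       "factors_through C m k \<longleftrightarrow> factors_through C n k" if "mono_arr C k" for k
    using that assms factors_through_trans unfolding mono_arr_def by metis+
  then show ?thesis
    unfolding sub_rep_def assms(4) by metis
qed

lemma Sub_mono:
  assumes "category C" and "s \<in> Sub C x"
  shows "mono_arr C s" "Cod C s = x"
  using assms sub_rep by (fastforce simp: Sub_def)+

lemma Sub_Hom: "category C \<Longrightarrow> s \<in> Sub C x \<Longrightarrow> s \<in> Hom C (Dom C s) x"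
  using Sub_mono mono_arr_Hom by fastforce

lemma sub_rep_Sub: "mono_arr C m \<Longrightarrow> Cod C m = x \<Longrightarrow> sub_rep C m \<in> Sub C x"
  by (auto simp: Sub_def)

text \<open>Representatives are fixed by \<open>sub_rep\<close>, so equivalent ones coincide. This
  supplies the uniqueness behind the definite descriptions in \<open>Eq\<close> and
  \<open>intersection\<close>.\<close>

lemma Sub_antisym:
  assumes "category C" and "m \<in> Sub C x" and "n \<in> Sub C x"
    and "factors_through C m n" and "factors_through C n m"
  shows "m = n"
proof -
  have "sub_rep C k = k" if k: "k \<in> Sub C x" for k
  proof -
    obtain m' where "k = sub_rep C m'" "mono_arr C m'"
      using k by (auto simp: Sub_def)
    then show ?thesis
      using assms(1) sub_rep sub_rep_eqI by metis
  qed
  then show ?thesis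
    using assms sub_rep_eqI Sub_mono by metis
qed

section \<open>Intersections as subobjects\<close>

lemma is_intersection_sub_rep:
  assumes "category C" and "is_intersection C x M m" and "M \<subseteq> Sub C x"
  shows "is_intersection C x M (sub_rep C m)"
proof -
  have m: "mono_arr C m" "Cod C m = x"
    using assms(2) by (auto simp: is_intersection_def)
  \<comment> \<open>The universal property involves only factorisations, so it is unchanged when
    \<open>m\<close> is replaced by an equivalent monomorphism. Chaining a factorisation into a
    member \<open>k\<close> of \<open>M\<close> requires \<open>k\<close> to be an arrow.\<close>
  have "k \<in> Arr C" if "k \<in> M" for k
    using that assms Sub_mono(1) by (fastforce simp: mono_arr_def)
  then show ?thesis
    using assms m sub_rep[OF assms(1) m(1)] factors_through_trans[OF assms(1)]
    unfolding is_intersection_def by (metis mono_arr_def)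
qed

text \<open>Existence passes from any intersection to its chosen representative. Two intersections
  factor through each other, so antisymmetry of representatives gives uniqueness.\<close>

lemma intersection:
  assumes "category C" and "has_intersections C" and "x \<in> Ob C" and "M \<subseteq> Sub C x"
  shows "intersection C x M \<in> Sub C x" "is_intersection C x M (intersection C x M)"
proof -
  obtain m where m: "is_intersection C x M m"
    using assms(2-4) unfolding has_intersections_def by blast
  have mono: "mono_arr C m" "Cod C m = x"
    using m by (auto simp: is_intersection_def)
  have r: "sub_rep C m \<in> Sub C x" "is_intersection C x M (sub_rep C m)"
    using sub_rep_Sub[OF mono] is_intersection_sub_rep[OF assms(1) m assms(4)] by auto
  have *: "factors_through C n n'" if "is_intersection C x M n" "is_intersection C x M n'" for n n'
    using that by (simp add: is_intersection_def mono_arr_def)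
  have "\<exists>!n. n \<in> Sub C x \<and> is_intersection C x M n"
  proof (rule ex1I)
    show "sub_rep C m \<in> Sub C x \<and> is_intersection C x M (sub_rep C m)"
      using r by blast
    fix n assume "n \<in> Sub C x \<and> is_intersection C x M n"
    then show "n = sub_rep C m"
      using Sub_antisym[OF assms(1)] * r by blast
  qed
  from theI'[OF this] show "intersection C x M \<in> Sub C x"
    "is_intersection C x M (intersection C x M)"
    unfolding intersection_def by blast+
qed

section \<open>Equalisers as subobjects\<close>

lemma is_equaliser_mono:
  assumes "category C" and "f \<in> Hom C x y" and "g \<in> Hom C x y" and "is_equaliser C f g e"
  shows "mono_arr C e"
  unfolding mono_arr_def
proof (intro conjI ballI impI)
  show "e \<in> Arr C"
    using assms(4) by (simp add: is_equaliser_def)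
  fix a b
  assume ab: "a \<in> Arr C" "b \<in> Arr C" "Dom C a = Dom C b" "Cod C a = Dom C e" "Cod C b = Dom C e"
    "e \<odot>\<^bsub>C\<^esub> a = e \<odot>\<^bsub>C\<^esub> b"
  have a: "a \<in> Hom C (Dom C a) (Dom C e)" and b: "b \<in> Hom C (Dom C a) (Dom C e)"
    using ab by (auto simp: Hom_def)
  have e: "e \<in> Hom C (Dom C e) x" "f \<odot>\<^bsub>C\<^esub> e = g \<odot>\<^bsub>C\<^esub> e"
    using assms by (auto simp: is_equaliser_def Hom_def)
  have ea: "e \<odot>\<^bsub>C\<^esub> a \<in> Hom C (Dom C a) x"
    using Comp_in_Hom[OF assms(1) a e(1)] .
  have "f \<odot>\<^bsub>C\<^esub> (e \<odot>\<^bsub>C\<^esub> a) = g \<odot>\<^bsub>C\<^esub> (e \<odot>\<^bsub>C\<^esub> a)"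
    using Comp_assoc[OF assms(1) a e(1)] assms(2,3) e(2) by metis
  \<comment> \<open>Both \<open>a\<close> and \<open>b\<close> are mediating arrows for the
    composite of \<open>e\<close> with \<open>a\<close>, so unique solvability of this problem
    identifies them.\<close>
  then have "\<exists>!h. h \<in> Hom C (Dom C a) (Dom C e) \<and> e \<odot>\<^bsub>C\<^esub> h = e \<odot>\<^bsub>C\<^esub> a"
    using assms(4) ea HomD[OF ea] HomD[OF assms(2)] unfolding is_equaliser_def by metis
  then show "a = b"
    using a b ab(6) by metis
qed

text \<open>This expresses the universal property by factorisation alone, a form that is insensitive
  to the choice of representative and combines with the universal property of intersections.\<close>

lemma factors_through_equaliser_iff:
  assumes "category C" and "f \<in> Hom C x y" and "g \<in> Hom C x y" and "is_equaliser C f g e"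
    and "k \<in> Hom C z x"
  shows "factors_through C k e \<longleftrightarrow> f \<odot>\<^bsub>C\<^esub> k = g \<odot>\<^bsub>C\<^esub> k"
proof
  have e: "e \<in> Hom C (Dom C e) x" "f \<odot>\<^bsub>C\<^esub> e = g \<odot>\<^bsub>C\<^esub> e"
    using assms by (auto simp: is_equaliser_def Hom_def)
  {
    assume "factors_through C k e"
    then obtain h where h: "h \<in> Hom C (Dom C k) (Dom C e)" "e \<odot>\<^bsub>C\<^esub> h = k"
      by (auto simp: factors_through_def)
    then show "f \<odot>\<^bsub>C\<^esub> k = g \<odot>\<^bsub>C\<^esub> k"
      using Comp_assoc[OF assms(1) h(1) e(1)] assms(2,3) e(2) by metis
  next
    assume "f \<odot>\<^bsub>C\<^esub> k = g \<odot>\<^bsub>C\<^esub> k"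
    then show "factors_through C k e"
      using assms(4) HomD[OF assms(5)] HomD[OF assms(2)]
      unfolding is_equaliser_def factors_through_def by metis
  }
qed

text \<open>Existence of mediating arrows transfers by composing factorisations; their uniqueness
  holds because the representative is monic.\<close>

lemma is_equaliser_sub_rep:
  assumes "category C" and "f \<in> Hom C x y" and "g \<in> Hom C x y" and "is_equaliser C f g e"
  shows "is_equaliser C f g (sub_rep C e)"
proof -
  have e: "mono_arr C e" "Cod C e = x"
    using is_equaliser_mono[OF assms] assms by (auto simp: is_equaliser_def Hom_def)
  note r = sub_rep[OF assms(1) e(1)]
  have r': "sub_rep C e \<in> Hom C (Dom C (sub_rep C e)) x"
    using mono_arr_Hom[OF r(1)] r(2) e(2) by simp
  have iff: "factors_through C k (sub_rep C e) \<longleftrightarrow> f \<odot>\<^bsub>C\<^esub> k = g \<odot>\<^bsub>C\<^esub> k" if "k \<in> Hom C z x" for k z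
    using factors_through_equaliser_iff[OF assms that] factors_through_trans[OF assms(1)] r e
    by (metis mono_arr_def)
  show ?thesis
    unfolding is_equaliser_def
  proof (intro conjI ballI impI)
    show "sub_rep C e \<in> Arr C" "Cod C (sub_rep C e) = Dom C f"
      using r' assms(2) by (auto simp: Hom_def)
    \<comment> \<open>This is \<open>iff\<close> at the representative itself, which factors through
      itself.\<close>
    show "f \<odot>\<^bsub>C\<^esub> sub_rep C e = g \<odot>\<^bsub>C\<^esub> sub_rep C e"
      using iff[OF r'] factors_through_refl[OF assms(1)] HomD(1)[OF r'] by metis
    fix k assume k: "k \<in> Arr C" "Cod C k = Dom C f" "f \<odot>\<^bsub>C\<^esub> k = g \<odot>\<^bsub>C\<^esub> k"
    then have "k \<in> Hom C (Dom C k) x"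
      using assms(2) by (auto simp: Hom_def)
    then have "factors_through C k (sub_rep C e)"
      using iff k(3) by blast
    then show "\<exists>!h. h \<in> Hom C (Dom C k) (Dom C (sub_rep C e)) \<and> sub_rep C e \<odot>\<^bsub>C\<^esub> h = k"
      using mono_arr_cancel[OF r(1)] unfolding factors_through_def by metis
  qed
qed

lemma Eq:
  assumes "category C" and "has_equalisers C" and "f \<in> Hom C x y" and "g \<in> Hom C x y"
  shows "Eq C f g \<in> Sub C x" "is_equaliser C f g (Eq C f g)"
proof -
  have xy: "x \<in> Ob C" "y \<in> Ob C" "Dom C f = x"
    using Hom_Ob[OF assms(1,3)] HomD[OF assms(3)] by auto
  obtain e where e: "is_equaliser C f g e"
    using assms(2-4) xy unfolding has_equalisers_def by blast
  have Cod: "Cod C e' = x" if "is_equaliser C f g e'" for e'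
    using that xy by (simp add: is_equaliser_def)
  have "\<exists>!n. n \<in> Sub C x \<and> is_equaliser C f g n"
  proof (rule ex1I)
    show r: "sub_rep C e \<in> Sub C x \<and> is_equaliser C f g (sub_rep C e)"
      using e Cod is_equaliser_sub_rep[OF assms(1,3,4)] is_equaliser_mono[OF assms(1,3,4)] sub_rep_Sub
      by metis
    fix n assume n: "n \<in> Sub C x \<and> is_equaliser C f g n"
    have "factors_through C m m'" if "m \<in> Sub C x" "is_equaliser C f g m" "is_equaliser C f g m'"
      for m m'
      using factors_through_equaliser_iff[OF assms(1,3,4) that(3) Sub_Hom[OF assms(1) that(1)]] that(2)
      by (simp add: is_equaliser_def)
    then show "n = sub_rep C e"
      using n r Sub_antisym[OF assms(1)] by blast
  qed
  from theI'[OF this] show "Eq C f g \<in> Sub C x" "is_equaliser C f g (Eq C f g)"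
    unfolding Eq_def xy by blast+
qed

section \<open>Powers\<close>

text \<open>Both arrows mediate one family, the components of \<open>f\<close>, so the uniqueness
  clause of the power identifies them: the projections are jointly monic.\<close>

lemma is_power_unique:
  assumes "category C" and "is_power C d J p \<pi>" and "f \<in> Hom C x p" and "g \<in> Hom C x p"
    and "\<And>j. j \<in> J \<Longrightarrow> \<pi> j \<odot>\<^bsub>C\<^esub> f = \<pi> j \<odot>\<^bsub>C\<^esub> g"
  shows "f = g"
proof -
  have "\<exists>!h. h \<in> Hom C x p \<and> (\<forall>j\<in>J. \<pi> j \<odot>\<^bsub>C\<^esub> h = k j)" if "\<forall>j\<in>J. k j \<in> Hom C x d" for k
    using assms(2) Hom_Ob(1)[OF assms(1,3)] that by (simp add: is_power_def)
  moreover have "\<forall>j\<in>J. \<pi> j \<odot>\<^bsub>C\<^esub> f \<in> Hom C x d"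
    using assms(2) Comp_in_Hom[OF assms(1,3)] by (simp add: is_power_def)
  ultimately have "\<exists>!h. h \<in> Hom C x p \<and> (\<forall>j\<in>J. \<pi> j \<odot>\<^bsub>C\<^esub> h = \<pi> j \<odot>\<^bsub>C\<^esub> f)" .
  moreover have "\<forall>j\<in>J. \<pi> j \<odot>\<^bsub>C\<^esub> g = \<pi> j \<odot>\<^bsub>C\<^esub> f"
    using assms(5) by simp
  ultimately show ?thesis
    using assms(3,4) by blast
qed

lemma tuple:
  assumes "is_power C d J p \<pi>" and "x \<in> Ob C" and "\<And>j. j \<in> J \<Longrightarrow> f j \<in> Hom C x d"
  shows "tuple C J p \<pi> x f \<in> Hom C x p" "\<And>j. j \<in> J \<Longrightarrow> \<pi> j \<odot>\<^bsub>C\<^esub> tuple C J p \<pi> x f = f j"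
proof -
  have "\<exists>!h. h \<in> Hom C x p \<and> (\<forall>j\<in>J. \<pi> j \<odot>\<^bsub>C\<^esub> h = f j)"
    using assms unfolding is_power_def by blast
  from theI'[OF this] show "tuple C J p \<pi> x f \<in> Hom C x p"
    "\<And>j. j \<in> J \<Longrightarrow> \<pi> j \<odot>\<^bsub>C\<^esub> tuple C J p \<pi> x f = f j"
    unfolding tuple_def by blast+
qed

section \<open>The operators and the adjunction\<close>

locale coseparated_powers =
  fixes U :: "'u itself"
    and T :: "('ot, 'at) cat"
    and S :: "('os, 'as) cat"
    and I :: "('ot, 'at, 'os, 'as) fctr"
    and \<Delta> :: 'ot
  assumes T: "category T" and S: "category S" and I: "is_functor T S I"
    and equalisers: "has_equalisers S" and intersections: "has_intersections S"
    and powers: "preserves_powers U T S I \<Delta>"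
    and coseparator: "coseparator T S I \<Delta>"
begin

abbreviation comp_T (infixl "\<cdot>" 70) where "g \<cdot> f \<equiv> g \<odot>\<^bsub>T\<^esub> f"
abbreviation comp_S (infixl "\<bullet>" 70) where "g \<bullet> f \<equiv> g \<odot>\<^bsub>S\<^esub> f"
abbreviation "D \<equiv> DD T S I"
abbreviation "Q \<equiv> QQ U T \<Delta>"
abbreviation "\<C> \<equiv> C_ob T S I \<Delta>"
abbreviation "\<V> \<equiv> V_ob S I"

section \<open>Properties of the congruence and subobject operators\<close>

lemma I_Comp_assoc:
  assumes "f \<in> Hom T t t'" and "p \<in> Hom T t' u" and "s \<in> Hom S y (omap I t)"
  shows "amap I (p \<cdot> f) \<bullet> s = amap I p \<bullet> (amap I f \<bullet> s)"
  using functor_Comp[OF I assms(1,2)]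
    Comp_assoc[OF S assms(3) functor_Hom[OF I assms(1)] functor_Hom[OF I assms(2)]] by simp

lemma Sub_in_Hom: "s \<in> Sub S x \<Longrightarrow> s \<in> Hom S (Dom S s) x"
  by (rule Sub_Hom[OF S])

text \<open>Preservation of powers makes the arrows \<open>amap I (\<pi> j)\<close> jointly monic.
  The images of the two tuples therefore agree along \<open>s\<close> because their components do,
  and following them by \<open>amap I g\<close> keeps the agreement.\<close>

lemma delta_congruence_CC:
  assumes t: "t \<in> Ob T" and s: "s \<in> Sub S (omap I t)"
  shows "delta_congruence U T \<Delta> t (CC T S I \<Delta> t s)"
  unfolding delta_congruence_def
proof (intro conjI allI impI ballI)
  show "equiv (Hom T t \<Delta>) (CC T S I \<Delta> t s)"
    by (auto simp: CC_def intro!: equivI refl_onI symI transI)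
  fix J :: "'u set" and p \<pi> g P Q'
  assume J: "small U J" and pow: "is_power T \<Delta> J p \<pi>" and g: "g \<in> Hom T p \<Delta>"
    and PQ: "\<forall>j\<in>J. (P j, Q' j) \<in> CC T S I \<Delta> t s"
  let ?P = "tuple T J p \<pi> t P" and ?Q = "tuple T J p \<pi> t Q'"
  have P: "?P \<in> Hom T t p" "\<And>j. j \<in> J \<Longrightarrow> \<pi> j \<cdot> ?P = P j"
    using tuple[OF pow t, of P] PQ by (auto simp: CC_def)
  have Q: "?Q \<in> Hom T t p" "\<And>j. j \<in> J \<Longrightarrow> \<pi> j \<cdot> ?Q = Q' j"
    using tuple[OF pow t, of Q'] PQ by (auto simp: CC_def)
  have pow_S: "is_power S (omap I \<Delta>) J (omap I p) (\<lambda>j. amap I (\<pi> j))"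
    using powers J pow unfolding preserves_powers_def by blast
  have "amap I ?P \<bullet> s = amap I ?Q \<bullet> s"
  proof (rule is_power_unique[OF S pow_S])
    show "amap I ?P \<bullet> s \<in> Hom S (Dom S s) (omap I p)" "amap I ?Q \<bullet> s \<in> Hom S (Dom S s) (omap I p)"
      using Comp_in_Hom[OF S Sub_in_Hom[OF s]] functor_Hom[OF I] P Q by auto
    fix j assume j: "j \<in> J"
    then have \<pi>: "\<pi> j \<in> Hom T p \<Delta>"
      using pow by (auto simp: is_power_def)
    show "amap I (\<pi> j) \<bullet> (amap I ?P \<bullet> s) = amap I (\<pi> j) \<bullet> (amap I ?Q \<bullet> s)"
      using PQ P(2) Q(2) j I_Comp_assoc[OF P(1) \<pi> Sub_in_Hom[OF s]]
        I_Comp_assoc[OF Q(1) \<pi> Sub_in_Hom[OF s]] by (auto simp: CC_def)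
  qed
  then show "(g \<cdot> ?P, g \<cdot> ?Q) \<in> CC T S I \<Delta> t s"
    using Comp_in_Hom[OF T P(1) g] Comp_in_Hom[OF T Q(1) g]
      I_Comp_assoc[OF P(1) g Sub_in_Hom[OF s]] I_Comp_assoc[OF Q(1) g Sub_in_Hom[OF s]]
    by (simp add: CC_def)
qed

lemma coseparator_eqI:
  assumes "t \<in> Ob T" and "g \<in> Hom S y (omap I t)" and "g' \<in> Hom S y (omap I t)"
    and "\<And>p. p \<in> Hom T t \<Delta> \<Longrightarrow> amap I p \<bullet> g = amap I p \<bullet> g'"
  shows "g = g'"
  using assms coseparator Hom_Ob(1)[OF S assms(2)] unfolding coseparator_def by blast

text \<open>An arrow factors through an intersection iff it factors through each member, and through
  an equaliser iff it equalises the pair. The arrow \<open>k\<close> may fail to be monic, so the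
  universal property of intersections against all arrows is what applies; later \<open>k\<close>
  will be \<open>amap I f \<bullet> s\<close>.\<close>

lemma VV:
  assumes t: "t \<in> Ob T" and R: "R \<subseteq> Hom T t \<Delta> \<times> Hom T t \<Delta>"
  shows VV_Sub: "VV S I t R \<in> Sub S (omap I t)"
    and factors_through_VV_iff: "k \<in> Hom S y (omap I t) \<Longrightarrow>
      factors_through S k (VV S I t R) \<longleftrightarrow> (\<forall>(p, q)\<in>R. amap I p \<bullet> k = amap I q \<bullet> k)"
proof -
  let ?M = "{Eq S (amap I p) (amap I q) |p q. (p, q) \<in> R}"
  have It: "omap I t \<in> Ob S"
    using functor_Ob[OF I t] .
  have Hom: "amap I p \<in> Hom S (omap I t) (omap I \<Delta>)" "amap I q \<in> Hom S (omap I t) (omap I \<Delta>)"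
    if "(p, q) \<in> R" for p q
    using that R functor_Hom[OF I] by blast+
  have M: "?M \<subseteq> Sub S (omap I t)"
    using Eq(1)[OF S equalisers Hom] by blast
  note int = intersection[OF S intersections It M]
  show V: "VV S I t R \<in> Sub S (omap I t)"
    using int(1) by (simp add: VV_def)
  assume k: "k \<in> Hom S y (omap I t)"
  have "factors_through S k (VV S I t R) \<longleftrightarrow> (\<forall>m\<in>?M. factors_through S k m)"
  proof
    assume "factors_through S k (VV S I t R)"
    moreover have "factors_through S (VV S I t R) m" if "m \<in> ?M" for m
      using int(2) that unfolding is_intersection_def VV_def by blast
    moreover have "m \<in> Arr S" if "m \<in> ?M" for m
      using that M Sub_in_Hom HomD(1) by (metis (no_types, lifting) subsetD)
    ultimately show "\<forall>m\<in>?M. factors_through S k m"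
      using factors_through_trans[OF S] by blast
  next
    assume "\<forall>m\<in>?M. factors_through S k m"
    then show "factors_through S k (VV S I t R)"
      using int(2) HomD[OF k] unfolding is_intersection_def VV_def by blast
  qed
  also have "\<dots> \<longleftrightarrow> (\<forall>(p, q)\<in>R. factors_through S k (Eq S (amap I p) (amap I q)))"
    by blast
  also have "\<dots> \<longleftrightarrow> (\<forall>(p, q)\<in>R. amap I p \<bullet> k = amap I q \<bullet> k)"
  proof (rule ball_cong[OF refl], clarify)
    fix p q assume "(p, q) \<in> R"
    from factors_through_equaliser_iff[OF S Hom[OF this] Eq(2)[OF S equalisers Hom[OF this]] k]
    show "factors_through S k (Eq S (amap I p) (amap I q)) \<longleftrightarrow> amap I p \<bullet> k = amap I q \<bullet> k" .
  qed
  finally show "factors_through S k (VV S I t R) \<longleftrightarrow> (\<forall>(p, q)\<in>R. amap I p \<bullet> k = amap I q \<bullet> k)" .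
qed

section \<open>Arrows induced by a given arrow of \<open>T\<close>\<close>

lemma Q_objectsD:
  assumes "(t, R) \<in> Ob Q"
  shows "t \<in> Ob T" "equiv (Hom T t \<Delta>) R" "R \<subseteq> Hom T t \<Delta> \<times> Hom T t \<Delta>"
  using assms by (auto simp: QQ_def Q_objects_def delta_congruence_def dest: equiv_type)

lemma D_objectsD:
  assumes "(t, s) \<in> Ob D"
  shows "t \<in> Ob T" "s \<in> Sub S (omap I t)" "s \<in> Hom S (Dom S s) (omap I t)" "mono_arr S s"
  using assms Sub_in_Hom Sub_mono[OF S] by (auto simp: DD_def D_objects_def)

lemma C_ob: "x \<in> Ob D \<Longrightarrow> \<C> x \<in> Ob Q"
  using delta_congruence_CC by (auto simp: DD_def D_objects_def QQ_def Q_objects_def C_ob_def)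

lemma V_ob: "y \<in> Ob Q \<Longrightarrow> \<V> y \<in> Ob D"
  using VV_Sub[OF Q_objectsD(1,3)] Q_objectsD(1)
  by (cases y) (auto simp: DD_def D_objects_def V_ob_def)

lemma Hom_D:
  "\<alpha> \<in> Hom D x y \<longleftrightarrow> x \<in> Ob D \<and> y \<in> Ob D \<and> (\<exists>g f. \<alpha> = (x, g, y) \<and> D_induces T S I f \<alpha>)"
  by (cases \<alpha>) (auto simp: Hom_def DD_def)

lemma Hom_Q:
  "\<beta> \<in> Hom Q y x \<longleftrightarrow> x \<in> Ob Q \<and> y \<in> Ob Q \<and> (\<exists>h f. \<beta> = (y, h, x) \<and> Q_induces T \<Delta> f \<beta>)"
  by (cases \<beta>) (auto simp: Hom_def QQ_def)

text \<open>The defining squares identify the two composites on the right with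
  \<open>s' \<bullet> g\<close> and \<open>s' \<bullet> g'\<close>, and \<open>s'\<close> is
  monic.\<close>

lemma D_induces_unique_iff:
  assumes "(t, s) \<in> Ob D" and "(t', s') \<in> Ob D"
    and "D_induces T S I f ((t, s), g, (t', s'))" and "D_induces T S I f' ((t, s), g', (t', s'))"
  shows "g = g' \<longleftrightarrow> amap I f \<bullet> s = amap I f' \<bullet> s"
  using assms(3,4) mono_arr_cancel[OF D_objectsD(4)[OF assms(2)]] by auto

lemma D_induces_ex_iff:
  assumes "(t, s) \<in> Ob D" and "f \<in> Hom T t t'"
  shows "(\<exists>g. D_induces T S I f ((t, s), g, (t', s'))) \<longleftrightarrow> factors_through S (amap I f \<bullet> s) s'"
proof -
  \<comment> \<open>An induced \<open>g\<close> is literally a factorisation witness; only the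
    source of the composite has to be computed.\<close>
  have "Dom S (amap I f \<bullet> s) = Dom S s"
    using HomD(2)[OF Comp_in_Hom[OF S D_objectsD(3)[OF assms(1)] functor_Hom[OF I assms(2)]]] .
  then show ?thesis
    using assms(2) by (auto simp: factors_through_def)
qed

text \<open>Both functions are extensional, so it suffices to compare them on the class of each
  \<open>p\<close>, where their values are the \<open>R\<close>-classes of
  \<open>p \<cdot> f\<close> and \<open>p \<cdot> f'\<close>. Since \<open>R\<close> is an
  equivalence relation, these classes coincide iff their representatives are related.\<close>

lemma Q_induces_unique_iff:
  assumes "(t, R) \<in> Ob Q" and "(t', R') \<in> Ob Q"
    and "Q_induces T \<Delta> f ((t', R'), h, (t, R))" and "Q_induces T \<Delta> f' ((t', R'), h', (t, R))"
  shows "h = h' \<longleftrightarrow> (\<forall>p\<in>Hom T t' \<Delta>. (p \<cdot> f, p \<cdot> f') \<in> R)"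
proof -
  have hh: "h \<in> (Hom T t' \<Delta> // R') \<rightarrow>\<^sub>E (Hom T t \<Delta> // R)" "h' \<in> (Hom T t' \<Delta> // R') \<rightarrow>\<^sub>E (Hom T t \<Delta> // R)"
    and f: "f \<in> Hom T t t'" "f' \<in> Hom T t t'"
    and val: "\<And>p. p \<in> Hom T t' \<Delta> \<Longrightarrow> h (R' `` {p}) = R `` {p \<cdot> f}"
      "\<And>p. p \<in> Hom T t' \<Delta> \<Longrightarrow> h' (R' `` {p}) = R `` {p \<cdot> f'}"
    using assms(3,4) by auto
  have "h = h' \<longleftrightarrow> (\<forall>X\<in>Hom T t' \<Delta> // R'. h X = h' X)"
    using PiE_ext[OF hh] by auto
  also have "\<dots> \<longleftrightarrow> (\<forall>p\<in>Hom T t' \<Delta>. R `` {p \<cdot> f} = R `` {p \<cdot> f'})"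
    using val by (auto simp: quotient_def)
  also have "\<dots> \<longleftrightarrow> (\<forall>p\<in>Hom T t' \<Delta>. (p \<cdot> f, p \<cdot> f') \<in> R)"
    using eq_equiv_class_iff[OF Q_objectsD(2)[OF assms(1)]] Comp_in_Hom[OF T] f by blast
  finally show ?thesis .
qed

lemma Q_induces_ex_iff:
  assumes "(t, R) \<in> Ob Q" and "(t', R') \<in> Ob Q" and "f \<in> Hom T t t'"
  shows "(\<exists>h. Q_induces T \<Delta> f ((t', R'), h, (t, R))) \<longleftrightarrow> (\<forall>(p, q)\<in>R'. (p \<cdot> f, q \<cdot> f) \<in> R)"
proof
  assume R: "\<forall>(p, q)\<in>R'. (p \<cdot> f, q \<cdot> f) \<in> R"
  note R_equiv = Q_objectsD(2)[OF assms(1)] and R'_equiv = Q_objectsD(2)[OF assms(2)]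
  \<comment> \<open>Instead of choosing a representative of \<open>X\<close>, collect everything
    that is \<open>R\<close>-related to a precomposite of some member of \<open>X\<close>. That this
    is a single class is shown next, and there the compatibility of \<open>f\<close> with
    \<open>R'\<close> and \<open>R\<close> enters.\<close>
  define h where "h = (\<lambda>X\<in>Hom T t' \<Delta> // R'. R `` ((\<lambda>p. p \<cdot> f) ` X))"
  have h: "h (R' `` {p}) = R `` {p \<cdot> f}" if p: "p \<in> Hom T t' \<Delta>" for p
  proof -
    have "R `` ((\<lambda>p. p \<cdot> f) ` (R' `` {p})) = R `` {p \<cdot> f}"
    proof
      show "R `` ((\<lambda>p. p \<cdot> f) ` (R' `` {p})) \<subseteq> R `` {p \<cdot> f}"
        using R R_equiv by (force simp: equiv_def elim: transE)
      show "R `` {p \<cdot> f} \<subseteq> R `` ((\<lambda>p. p \<cdot> f) ` (R' `` {p}))"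
        using equiv_class_self[OF R'_equiv p] by blast
    qed
    then show ?thesis
      using quotientI[OF p, of R'] by (simp add: h_def)
  qed
  have "h \<in> (Hom T t' \<Delta> // R') \<rightarrow>\<^sub>E (Hom T t \<Delta> // R)"
  proof (rule PiE_I)
    fix X assume "X \<in> Hom T t' \<Delta> // R'"
    then obtain p where p: "X = R' `` {p}" "p \<in> Hom T t' \<Delta>"
      by (rule quotientE)
    then show "h X \<in> Hom T t \<Delta> // R"
      using h quotientI[OF Comp_in_Hom[OF T assms(3) p(2)]] by simp
  qed (simp add: h_def)
  then have "Q_induces T \<Delta> f ((t', R'), h, (t, R))"
    using assms(3) R h by simp
  then show "\<exists>h. Q_induces T \<Delta> f ((t', R'), h, (t, R))"
    by blast
qed auto

lemma D_eq_iff: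
  assumes "\<alpha> \<in> Hom D x y" and "\<alpha>' \<in> Hom D x y"
    and "D_induces T S I f \<alpha>" and "D_induces T S I f' \<alpha>'"
  shows "\<alpha> = \<alpha>' \<longleftrightarrow> amap I f \<bullet> snd x = amap I f' \<bullet> snd x"
proof (cases x, cases y)
  fix t s t' s' assume xy: "x = (t, s)" "y = (t', s')"
  obtain g g' where g: "\<alpha> = (x, g, y)" "\<alpha>' = (x, g', y)"
    using assms(1,2) by (auto simp: Hom_D)
  show ?thesis
    using D_induces_unique_iff[of t s t' s' f g f' g'] assms Hom_D by (simp add: g xy)
qed

lemma Q_eq_iff:
  assumes "\<beta> \<in> Hom Q y x" and "\<beta>' \<in> Hom Q y x"
    and "Q_induces T \<Delta> f \<beta>" and "Q_induces T \<Delta> f' \<beta>'"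
  shows "\<beta> = \<beta>' \<longleftrightarrow> (\<forall>p\<in>Hom T (fst y) \<Delta>. (p \<cdot> f, p \<cdot> f') \<in> snd x)"
proof (cases x, cases y)
  fix t R t' R' assume xy: "x = (t, R)" "y = (t', R')"
  obtain h h' where h: "\<beta> = (y, h, x)" "\<beta>' = (y, h', x)"
    using assms(1,2) by (auto simp: Hom_Q)
  show ?thesis
    using Q_induces_unique_iff[of t R t' R' f h f' h'] assms Hom_Q by (simp add: h xy)
qed

lemma D_induces_Hom: "\<alpha> \<in> Hom D x y \<Longrightarrow> D_induces T S I f \<alpha> \<Longrightarrow> f \<in> Hom T (fst x) (fst y)"
  by (cases x; cases y) (auto simp: Hom_D)

lemma Q_induces_Hom: "\<beta> \<in> Hom Q y x \<Longrightarrow> Q_induces T \<Delta> f \<beta> \<Longrightarrow> f \<in> Hom T (fst x) (fst y)"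
  by (cases x; cases y) (auto simp: Hom_Q)

lemma D_obtain:
  assumes "\<alpha> \<in> Hom D x y"
  obtains f where "D_induces T S I f \<alpha>"
  using assms by (auto simp: Hom_D)

lemma Q_obtain:
  assumes "\<beta> \<in> Hom Q y x"
  obtains f where "Q_induces T \<Delta> f \<beta>"
  using assms by (auto simp: Hom_Q)

text \<open>The device for proving equations in \<open>D\<close>: parallel arrows coincide as soon
  as one arrow of \<open>T\<close> induces both. It reduces the category laws to those of
  \<open>T\<close>.\<close>

lemma D_induces_inj:
  assumes "\<alpha> \<in> Hom D x y" and "\<alpha>' \<in> Hom D x y"
    and "D_induces T S I f \<alpha>" and "D_induces T S I f \<alpha>'"
  shows "\<alpha> = \<alpha>'"
  using D_eq_iff[OF assms] by simp

text \<open>The same device in \<open>Q\<close>; the criterion of \<open>Q_eq_iff\<close> becomes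
  reflexivity of the relation on the target.\<close>

lemma Q_induces_inj:
  assumes "\<beta> \<in> Hom Q y x" and "\<beta>' \<in> Hom Q y x"
    and "Q_induces T \<Delta> f \<beta>" and "Q_induces T \<Delta> f \<beta>'"
  shows "\<beta> = \<beta>'"
proof -
  obtain t R where x: "x = (t, R)" by fastforce
  have "(t, R) \<in> Ob Q"
    using assms(1) by (simp add: Hom_Q x)
  note R = Q_objectsD(2)[OF this]
  have "\<forall>p\<in>Hom T (fst y) \<Delta>. (p \<cdot> f, p \<cdot> f) \<in> R"
    using equiv_class_self[OF R] Comp_in_Hom[OF T Q_induces_Hom[OF assms(1,3)]] by (simp add: x)
  then show ?thesis
    using Q_eq_iff[OF assms] by (simp add: x)
qed

section \<open>Composition, identities and the category laws\<close>

lemma D_Comp: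
  assumes "\<alpha> \<in> Hom D x y" and "\<beta> \<in> Hom D y z"
  shows D_Comp_Hom: "\<beta> \<odot>\<^bsub>D\<^esub> \<alpha> \<in> Hom D x z"
    and D_induces_Comp: "D_induces T S I f \<alpha> \<Longrightarrow> D_induces T S I f' \<beta> \<Longrightarrow>
      D_induces T S I (f' \<cdot> f) (\<beta> \<odot>\<^bsub>D\<^esub> \<alpha>)"
proof -
  obtain t s where x: "x = (t, s)" by fastforce
  obtain t' s' where y: "y = (t', s')" by fastforce
  obtain t'' s'' where z: "z = (t'', s'')" by fastforce
  obtain g g' where g: "\<alpha> = (x, g, y)" "\<beta> = (y, g', z)"
    using assms by (auto simp: Hom_D)
  have Ob: "x \<in> Ob D" "y \<in> Ob D" "z \<in> Ob D"
    using assms by (auto simp: Hom_D)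
  have Comp: "\<beta> \<odot>\<^bsub>D\<^esub> \<alpha> = (x, g' \<bullet> g, z)"
    by (simp add: g DD_def)
  show *: "D_induces T S I (f' \<cdot> f) (\<beta> \<odot>\<^bsub>D\<^esub> \<alpha>)"
    if \<alpha>: "D_induces T S I f \<alpha>" and \<beta>: "D_induces T S I f' \<beta>" for f f'
  proof -
    have f: "f \<in> Hom T t t'" "g \<in> Hom S (Dom S s) (Dom S s')" "amap I f \<bullet> s = s' \<bullet> g"
      and f': "f' \<in> Hom T t' t''" "g' \<in> Hom S (Dom S s') (Dom S s'')" "amap I f' \<bullet> s' = s'' \<bullet> g'"
      using \<alpha> \<beta> by (auto simp: x y z g)
    have s: "s \<in> Hom S (Dom S s) (omap I t)" "s' \<in> Hom S (Dom S s') (omap I t')"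
      "s'' \<in> Hom S (Dom S s'') (omap I t'')"
      using Ob D_objectsD(3) by (auto simp: x y z)
    \<comment> \<open>The commuting squares of \<open>\<alpha>\<close> and \<open>\<beta>\<close>
      are pasted side by side.\<close>
    have "amap I (f' \<cdot> f) \<bullet> s = amap I f' \<bullet> (s' \<bullet> g)"
      using I_Comp_assoc[OF f(1) f'(1) s(1)] f(3) by simp
    also have "\<dots> = s'' \<bullet> g' \<bullet> g"
      using Comp_assoc[OF S f(2) s(2) functor_Hom[OF I f'(1)]] f'(3) by simp
    also have "\<dots> = s'' \<bullet> (g' \<bullet> g)"
      using Comp_assoc[OF S f(2) f'(2) s(3)] by simp
    finally show ?thesis
      using Comp_in_Hom[OF T f(1) f'(1)] Comp_in_Hom[OF S f(2) f'(2)] by (simp add: Comp x z)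
  qed
  \<comment> \<open>Membership in the hom-set asks for some inducing arrow, so one is picked for
    each factor.\<close>
  obtain f f' where "D_induces T S I f \<alpha>" "D_induces T S I f' \<beta>"
    using D_obtain[OF assms(1)] D_obtain[OF assms(2)] by metis
  from *[OF this] show "\<beta> \<odot>\<^bsub>D\<^esub> \<alpha> \<in> Hom D x z"
    using Ob Comp unfolding Hom_D by blast
qed

text \<open>Composition in \<open>Q\<close> runs against \<open>T\<close>: the function of
  \<open>\<beta>\<close> acts first, yet its inducing arrow \<open>f'\<close> comes last in
  \<open>f' \<cdot> f\<close>, because classes are transported by precomposition.\<close>

lemma Q_Comp:
  assumes "\<alpha> \<in> Hom Q y x" and "\<beta> \<in> Hom Q z y"
  shows Q_Comp_Hom: "\<alpha> \<odot>\<^bsub>Q\<^esub> \<beta> \<in> Hom Q z x"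
    and Q_induces_Comp: "Q_induces T \<Delta> f \<alpha> \<Longrightarrow> Q_induces T \<Delta> f' \<beta> \<Longrightarrow>
      Q_induces T \<Delta> (f' \<cdot> f) (\<alpha> \<odot>\<^bsub>Q\<^esub> \<beta>)"
proof -
  obtain t R where x: "x = (t, R)" by fastforce
  obtain t' R' where y: "y = (t', R')" by fastforce
  obtain t'' R'' where z: "z = (t'', R'')" by fastforce
  obtain h h' where h: "\<alpha> = (y, h, x)" "\<beta> = (z, h', y)"
    using assms by (auto simp: Hom_Q)
  have Ob: "x \<in> Ob Q" "y \<in> Ob Q" "z \<in> Ob Q"
    using assms by (auto simp: Hom_Q)
  let ?h = "compose (Hom T t'' \<Delta> // R'') h h'"
  have Comp: "\<alpha> \<odot>\<^bsub>Q\<^esub> \<beta> = (z, ?h, x)"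
    by (simp add: h QQ_def Q_carrier_def z)
  show *: "Q_induces T \<Delta> (f' \<cdot> f) (\<alpha> \<odot>\<^bsub>Q\<^esub> \<beta>)"
    if \<alpha>: "Q_induces T \<Delta> f \<alpha>" and \<beta>: "Q_induces T \<Delta> f' \<beta>" for f f'
  proof -
    have f: "f \<in> Hom T t t'" "h \<in> (Hom T t' \<Delta> // R') \<rightarrow>\<^sub>E (Hom T t \<Delta> // R)"
        "\<And>p q. (p, q) \<in> R' \<Longrightarrow> (p \<cdot> f, q \<cdot> f) \<in> R"
        "\<And>p. p \<in> Hom T t' \<Delta> \<Longrightarrow> h (R' `` {p}) = R `` {p \<cdot> f}"
      and f': "f' \<in> Hom T t' t''" "h' \<in> (Hom T t'' \<Delta> // R'') \<rightarrow>\<^sub>E (Hom T t' \<Delta> // R')"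
        "\<And>p q. (p, q) \<in> R'' \<Longrightarrow> (p \<cdot> f', q \<cdot> f') \<in> R'"
        "\<And>p. p \<in> Hom T t'' \<Delta> \<Longrightarrow> h' (R'' `` {p}) = R' `` {p \<cdot> f'}"
      using \<alpha> \<beta> by (auto simp: x y z h)
    note assoc = Comp_assoc[OF T f(1) f'(1)]
    have "?h \<in> (Hom T t'' \<Delta> // R'') \<rightarrow>\<^sub>E (Hom T t \<Delta> // R)"
      using f(2) f'(2) by (auto simp: compose_def)
    moreover have "(p \<cdot> (f' \<cdot> f), q \<cdot> (f' \<cdot> f)) \<in> R" if pq: "(p, q) \<in> R''" for p q
    proof -
      have "p \<in> Hom T t'' \<Delta>" "q \<in> Hom T t'' \<Delta>"
        using Q_objectsD(3)[of t'' R''] Ob(3) pq by (auto simp: z)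
      then show ?thesis
        using assoc f(3)[OF f'(3)[OF pq]] by simp
    qed
    moreover have "?h (R'' `` {p}) = R `` {p \<cdot> (f' \<cdot> f)}" if p: "p \<in> Hom T t'' \<Delta>" for p
      using f'(4)[OF p] f(4)[OF Comp_in_Hom[OF T f'(1) p]] assoc[OF p] quotientI[OF p, of R'']
      by (simp add: compose_def)
    ultimately show ?thesis
      using Comp_in_Hom[OF T f(1) f'(1)] by (auto simp: Comp x z)
  qed
  obtain f f' where "Q_induces T \<Delta> f \<alpha>" "Q_induces T \<Delta> f' \<beta>"
    using Q_obtain[OF assms(1)] Q_obtain[OF assms(2)] by metis
  from *[OF this] show "\<alpha> \<odot>\<^bsub>Q\<^esub> \<beta> \<in> Hom Q z x"
    using Ob Comp unfolding Hom_Q by blast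
qed

lemma D_Id:
  assumes "x \<in> Ob D"
  shows D_induces_Id: "D_induces T S I (Id T (fst x)) (Id D x)"
    and D_Id_Hom: "Id D x \<in> Hom D x x"
proof -
  obtain t s where x: "x = (t, s)" by fastforce
  note o = D_objectsD[OF assms[unfolded x]]
  have Id: "Id D x = (x, Id S (Dom S s), x)"
    by (simp add: DD_def x)
  show "D_induces T S I (Id T (fst x)) (Id D x)"
    using Id_in_Hom[OF T o(1)] Id_in_Hom[OF S Hom_Ob(1)[OF S o(3)]] functor_Id[OF I o(1)]
      Comp_Id[OF S o(3)] by (simp add: DD_def x)
  then show "Id D x \<in> Hom D x x"
    using assms Id unfolding Hom_D by blast
qed

lemma Q_Id:
  assumes "x \<in> Ob Q"
  shows Q_induces_Id: "Q_induces T \<Delta> (Id T (fst x)) (Id Q x)"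
    and Q_Id_Hom: "Id Q x \<in> Hom Q x x"
proof -
  obtain t R where x: "x = (t, R)" by fastforce
  note o = Q_objectsD[OF assms[unfolded x]]
  have "p \<cdot> Id T t = p" "q \<cdot> Id T t = q" if "(p, q) \<in> R" for p q
    using that o(3) Comp_Id(1)[OF T] by blast+
  then show "Q_induces T \<Delta> (Id T (fst x)) (Id Q x)"
    using Id_in_Hom[OF T o(1)] Comp_Id(1)[OF T] quotientI[of _ "Hom T t \<Delta>" R]
    by (auto simp: QQ_def Q_carrier_def x)
  moreover have "Id Q x = (x, restrict id (Q_carrier T \<Delta> x), x)"
    by (simp add: QQ_def)
  ultimately show "Id Q x \<in> Hom Q x x"
    using assms unfolding Hom_Q by blast
qed

text \<open>Each equational law follows from \<open>D_induces_inj\<close> once a single arrow of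
  \<open>T\<close> is seen to induce both sides; that the two inducing composites are equal is the
  same law in \<open>T\<close>.\<close>

lemma category_D: "category D"
proof (rule categoryI)
  fix \<alpha> assume "\<alpha> \<in> Arr D"
  then show "Dom D \<alpha> \<in> Ob D \<and> Cod D \<alpha> \<in> Ob D"
    by (auto simp: DD_def)
next
  fix \<alpha> x y assume \<alpha>: "\<alpha> \<in> Hom D x y"
  then obtain f where f: "D_induces T S I f \<alpha>"
    by (rule D_obtain)
  have Ob: "x \<in> Ob D" "y \<in> Ob D"
    using \<alpha> by (auto simp: Hom_D)
  note Id = Comp_Id[OF T D_induces_Hom[OF \<alpha> f]]
  show "\<alpha> \<odot>\<^bsub>D\<^esub> Id D x = \<alpha> \<and> Id D y \<odot>\<^bsub>D\<^esub> \<alpha> = \<alpha>"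
    using D_induces_inj[OF D_Comp_Hom[OF D_Id_Hom[OF Ob(1)] \<alpha>] \<alpha>]
      D_induces_inj[OF D_Comp_Hom[OF \<alpha> D_Id_Hom[OF Ob(2)]] \<alpha>]
      D_induces_Comp[OF D_Id_Hom[OF Ob(1)] \<alpha> D_induces_Id[OF Ob(1)] f]
      D_induces_Comp[OF \<alpha> D_Id_Hom[OF Ob(2)] f D_induces_Id[OF Ob(2)]] f
    unfolding Id by blast
next
  fix \<alpha> \<beta> \<gamma> x y z w
  assume \<alpha>: "\<alpha> \<in> Hom D x y" and \<beta>: "\<beta> \<in> Hom D y z" and \<gamma>: "\<gamma> \<in> Hom D z w"
  obtain f g h where f: "D_induces T S I f \<alpha>" and g: "D_induces T S I g \<beta>" and h: "D_induces T S I h \<gamma>"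
    using D_obtain[OF \<alpha>] D_obtain[OF \<beta>] D_obtain[OF \<gamma>] by metis
  note \<beta>\<alpha> = D_Comp_Hom[OF \<alpha> \<beta>] and \<gamma>\<beta> = D_Comp_Hom[OF \<beta> \<gamma>]
  show "\<gamma> \<odot>\<^bsub>D\<^esub> (\<beta> \<odot>\<^bsub>D\<^esub> \<alpha>) = (\<gamma> \<odot>\<^bsub>D\<^esub> \<beta>) \<odot>\<^bsub>D\<^esub> \<alpha>"
  proof (rule D_induces_inj[OF D_Comp_Hom[OF \<beta>\<alpha> \<gamma>] D_Comp_Hom[OF \<alpha> \<gamma>\<beta>]])
    show "D_induces T S I (h \<cdot> (g \<cdot> f)) (\<gamma> \<odot>\<^bsub>D\<^esub> (\<beta> \<odot>\<^bsub>D\<^esub> \<alpha>))"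
      by (rule D_induces_Comp[OF \<beta>\<alpha> \<gamma> D_induces_Comp[OF \<alpha> \<beta> f g] h])
    show "D_induces T S I (h \<cdot> (g \<cdot> f)) ((\<gamma> \<odot>\<^bsub>D\<^esub> \<beta>) \<odot>\<^bsub>D\<^esub> \<alpha>)"
      using D_induces_Comp[OF \<alpha> \<gamma>\<beta> f D_induces_Comp[OF \<beta> \<gamma> g h]]
        Comp_assoc[OF T D_induces_Hom[OF \<alpha> f] D_induces_Hom[OF \<beta> g] D_induces_Hom[OF \<gamma> h]] by simp
  qed
qed (rule D_Id_Hom D_Comp_Hom; assumption)+

text \<open>The argument for \<open>D\<close> with inducing arrows composed in reverse order: the
  identity at the source of a \<open>Q\<close>-arrow acts on the left of its inducing arrow.\<close>

lemma category_Q: "category Q"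
proof (rule categoryI)
  fix \<alpha> assume "\<alpha> \<in> Arr Q"
  then show "Dom Q \<alpha> \<in> Ob Q \<and> Cod Q \<alpha> \<in> Ob Q"
    by (auto simp: QQ_def)
next
  fix \<alpha> x y assume \<alpha>: "\<alpha> \<in> Hom Q x y"
  then obtain f where f: "Q_induces T \<Delta> f \<alpha>"
    by (rule Q_obtain)
  have Ob: "x \<in> Ob Q" "y \<in> Ob Q"
    using \<alpha> by (auto simp: Hom_Q)
  note Id = Comp_Id[OF T Q_induces_Hom[OF \<alpha> f]]
  show "\<alpha> \<odot>\<^bsub>Q\<^esub> Id Q x = \<alpha> \<and> Id Q y \<odot>\<^bsub>Q\<^esub> \<alpha> = \<alpha>"
    using Q_induces_inj[OF Q_Comp_Hom[OF \<alpha> Q_Id_Hom[OF Ob(1)]] \<alpha>]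
      Q_induces_inj[OF Q_Comp_Hom[OF Q_Id_Hom[OF Ob(2)] \<alpha>] \<alpha>]
      Q_induces_Comp[OF \<alpha> Q_Id_Hom[OF Ob(1)] f Q_induces_Id[OF Ob(1)]]
      Q_induces_Comp[OF Q_Id_Hom[OF Ob(2)] \<alpha> Q_induces_Id[OF Ob(2)] f] f
    unfolding Id by blast
next
  fix \<alpha> \<beta> \<gamma> x y z w
  assume \<alpha>: "\<alpha> \<in> Hom Q x y" and \<beta>: "\<beta> \<in> Hom Q y z" and \<gamma>: "\<gamma> \<in> Hom Q z w"
  obtain f g h where f: "Q_induces T \<Delta> f \<alpha>" and g: "Q_induces T \<Delta> g \<beta>" and h: "Q_induces T \<Delta> h \<gamma>"
    using Q_obtain[OF \<alpha>] Q_obtain[OF \<beta>] Q_obtain[OF \<gamma>] by metis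
  note \<beta>\<alpha> = Q_Comp_Hom[OF \<beta> \<alpha>] and \<gamma>\<beta> = Q_Comp_Hom[OF \<gamma> \<beta>]
  show "\<gamma> \<odot>\<^bsub>Q\<^esub> (\<beta> \<odot>\<^bsub>Q\<^esub> \<alpha>) = (\<gamma> \<odot>\<^bsub>Q\<^esub> \<beta>) \<odot>\<^bsub>Q\<^esub> \<alpha>"
  proof (rule Q_induces_inj[OF Q_Comp_Hom[OF \<gamma> \<beta>\<alpha>] Q_Comp_Hom[OF \<gamma>\<beta> \<alpha>]])
    show "Q_induces T \<Delta> (f \<cdot> g \<cdot> h) (\<gamma> \<odot>\<^bsub>Q\<^esub> (\<beta> \<odot>\<^bsub>Q\<^esub> \<alpha>))"
      by (rule Q_induces_Comp[OF \<gamma> \<beta>\<alpha> h Q_induces_Comp[OF \<beta> \<alpha> g f]])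
    show "Q_induces T \<Delta> (f \<cdot> g \<cdot> h) ((\<gamma> \<odot>\<^bsub>Q\<^esub> \<beta>) \<odot>\<^bsub>Q\<^esub> \<alpha>)"
      using Q_induces_Comp[OF \<gamma>\<beta> \<alpha> Q_induces_Comp[OF \<gamma> \<beta> h g] f]
        Comp_assoc[OF T Q_induces_Hom[OF \<gamma> h] Q_induces_Hom[OF \<beta> g] Q_induces_Hom[OF \<alpha> f]] by simp
  qed
qed (rule Q_Id_Hom Q_Comp_Hom; assumption)+

section \<open>Comparison of induced arrows in \<open>D\<close> and in \<open>Q\<close>\<close>

lemma Q_CC_eq_iff:
  assumes x: "x \<in> Ob D"
    and \<beta>: "\<beta> \<in> Hom Q y (\<C> x)" "\<beta>' \<in> Hom Q y (\<C> x)"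
    and ind: "Q_induces T \<Delta> f \<beta>" "Q_induces T \<Delta> f' \<beta>'"
  shows "\<beta> = \<beta>' \<longleftrightarrow> amap I f \<bullet> snd x = amap I f' \<bullet> snd x"
proof -
  obtain t s where ts: "x = (t, s)" by fastforce
  obtain t' R' where y: "y = (t', R')" by fastforce
  note o = D_objectsD[OF x[unfolded ts]]
  have f: "f \<in> Hom T t t'" "f' \<in> Hom T t t'"
    using Q_induces_Hom[OF \<beta>(1) ind(1)] Q_induces_Hom[OF \<beta>(2) ind(2)] by (auto simp: ts y C_ob_def)
  have t': "t' \<in> Ob T"
    using Hom_Ob(2)[OF T f(1)] .
  have If: "amap I f \<bullet> s \<in> Hom S (Dom S s) (omap I t')" "amap I f' \<bullet> s \<in> Hom S (Dom S s) (omap I t')"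
    using Comp_in_Hom[OF S o(3)] functor_Hom[OF I] f by blast+
  have "\<beta> = \<beta>' \<longleftrightarrow> (\<forall>p\<in>Hom T t' \<Delta>. (p \<cdot> f, p \<cdot> f') \<in> CC T S I \<Delta> t s)"
    using Q_eq_iff[OF \<beta> ind] by (simp add: ts y C_ob_def)
  \<comment> \<open>Membership in \<open>CC\<close> means agreement along \<open>s\<close> after
    applying \<open>I\<close>; functoriality moves \<open>f\<close> and \<open>f'\<close> next to
    \<open>s\<close>.\<close>
  also have "\<dots> \<longleftrightarrow> (\<forall>p\<in>Hom T t' \<Delta>. amap I p \<bullet> (amap I f \<bullet> s) = amap I p \<bullet> (amap I f' \<bullet> s))"
    using I_Comp_assoc[OF f(1) _ o(3)] I_Comp_assoc[OF f(2) _ o(3)]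
      Comp_in_Hom[OF T f(1)] Comp_in_Hom[OF T f(2)] by (simp add: CC_def)
  \<comment> \<open>Here \<open>p\<close> ranges over all arrows from \<open>t'\<close> to
    \<open>\<Delta>\<close>, whose images jointly distinguish arrows into \<open>omap I t'\<close>
    by coseparation.\<close>
  also have "\<dots> \<longleftrightarrow> amap I f \<bullet> s = amap I f' \<bullet> s"
    using coseparator_eqI[OF t' If] by metis
  finally show ?thesis
    by (simp add: ts)
qed

lemma D_ex_iff:
  assumes "x \<in> Ob D" and "y \<in> Ob D" and "f \<in> Hom T (fst x) (fst y)"
  shows "(\<exists>\<alpha>\<in>Hom D x y. D_induces T S I f \<alpha>) \<longleftrightarrow> factors_through S (amap I f \<bullet> snd x) (snd y)"
proof (cases x, cases y)
  fix t s t' s' assume xy: "x = (t, s)" "y = (t', s')"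
  have "(\<exists>\<alpha>\<in>Hom D x y. D_induces T S I f \<alpha>) \<longleftrightarrow> (\<exists>g. D_induces T S I f ((t, s), g, (t', s')))"
    using assms unfolding Hom_D Bex_def xy by blast
  then show ?thesis
    using D_induces_ex_iff[of t s f t' s'] assms by (simp add: xy)
qed

lemma Q_ex_iff:
  assumes "x \<in> Ob Q" and "y \<in> Ob Q" and "f \<in> Hom T (fst x) (fst y)"
  shows "(\<exists>\<beta>\<in>Hom Q y x. Q_induces T \<Delta> f \<beta>) \<longleftrightarrow> (\<forall>(p, q)\<in>snd y. (p \<cdot> f, q \<cdot> f) \<in> snd x)"
proof (cases x, cases y)
  fix t R t' R' assume xy: "x = (t, R)" "y = (t', R')"
  have "(\<exists>\<beta>\<in>Hom Q y x. Q_induces T \<Delta> f \<beta>) \<longleftrightarrow> (\<exists>h. Q_induces T \<Delta> f ((t', R'), h, (t, R)))"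
    using assms unfolding Hom_Q Bex_def xy by blast
  then show ?thesis
    using Q_induces_ex_iff[of t R t' R' f] assms by (simp add: xy)
qed

text \<open>Both sides reduce to \<open>amap I f \<bullet> s\<close> equalising the image of every
  pair in \<open>R\<close>: one by unfolding \<open>CC\<close>, the other by
  \<open>factors_through_VV_iff\<close>. Existence of transposes and surjectivity of transposition
  both come from here.\<close>

lemma Q_ex_iff_D_ex:
  assumes x: "x \<in> Ob D" and y: "y \<in> Ob Q" and f: "f \<in> Hom T (fst x) (fst y)"
  shows "(\<exists>\<beta>\<in>Hom Q y (\<C> x). Q_induces T \<Delta> f \<beta>) \<longleftrightarrow> (\<exists>\<alpha>\<in>Hom D x (\<V> y). D_induces T S I f \<alpha>)"
proof -
  obtain t s where ts: "x = (t, s)" by fastforce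
  obtain t' R where tR: "y = (t', R)" by fastforce
  note s = D_objectsD[OF x[unfolded ts]] and R = Q_objectsD[OF y[unfolded tR]]
  have f': "f \<in> Hom T t t'"
    using f by (simp add: ts tR)
  have fst: "f \<in> Hom T (fst (\<C> x)) (fst y)" "f \<in> Hom T (fst x) (fst (\<V> y))"
    using f' by (simp_all add: ts tR C_ob_def V_ob_def)
  have If: "amap I f \<bullet> s \<in> Hom S (Dom S s) (omap I t')"
    by (rule Comp_in_Hom[OF S s(3) functor_Hom[OF I f']])
  have *: "(p \<cdot> f, q \<cdot> f) \<in> CC T S I \<Delta> t s \<longleftrightarrow>
      amap I p \<bullet> (amap I f \<bullet> s) = amap I q \<bullet> (amap I f \<bullet> s)" if "(p, q) \<in> R" for p q
  proof -
    have "p \<in> Hom T t' \<Delta>" "q \<in> Hom T t' \<Delta>"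
      using that R(3) by blast+
    then show ?thesis
      using I_Comp_assoc[OF f' _ s(3)] Comp_in_Hom[OF T f'] by (simp add: CC_def)
  qed
  have "(\<exists>\<beta>\<in>Hom Q y (\<C> x). Q_induces T \<Delta> f \<beta>) \<longleftrightarrow>
      (\<forall>(p, q)\<in>R. (p \<cdot> f, q \<cdot> f) \<in> CC T S I \<Delta> t s)"
    using Q_ex_iff[OF C_ob[OF x] y fst(1)] by (simp add: ts tR C_ob_def)
  also have "\<dots> \<longleftrightarrow> (\<forall>(p, q)\<in>R. amap I p \<bullet> (amap I f \<bullet> s) = amap I q \<bullet> (amap I f \<bullet> s))"
    using * by blast
  also have "\<dots> \<longleftrightarrow> factors_through S (amap I f \<bullet> s) (VV S I t' R)"
    using factors_through_VV_iff[OF R(1,3) If] by simp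
  also have "\<dots> \<longleftrightarrow> (\<exists>\<alpha>\<in>Hom D x (\<V> y). D_induces T S I f \<alpha>)"
    using D_ex_iff[OF x V_ob[OF y] fst(2)] by (simp add: ts tR V_ob_def)
  finally show ?thesis .
qed

text \<open>If the images of \<open>p\<close> and \<open>q\<close> agree along \<open>s'\<close>,
  they agree along \<open>s' \<bullet> g\<close>, which is
  \<open>amap I f \<bullet> s\<close>.\<close>

lemma C_ex:
  assumes \<alpha>: "\<alpha> \<in> Hom D x y" and ind: "D_induces T S I f \<alpha>"
  shows "\<exists>\<beta>\<in>Hom Q (\<C> y) (\<C> x). Q_induces T \<Delta> f \<beta>"
proof -
  obtain t s where x: "x = (t, s)" by fastforce
  obtain t' s' where y: "y = (t', s')" by fastforce
  have Ob: "x \<in> Ob D" "y \<in> Ob D"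
    using \<alpha> by (auto simp: Hom_D)
  obtain g where g: "\<alpha> = (x, g, y)"
    using \<alpha> by (auto simp: Hom_D)
  have f: "f \<in> Hom T t t'" and g': "g \<in> Hom S (Dom S s) (Dom S s')" "amap I f \<bullet> s = s' \<bullet> g"
    using ind by (auto simp: g x y)
  note s = D_objectsD(3)[OF Ob(1)[unfolded x]] and s' = D_objectsD(3)[OF Ob(2)[unfolded y]]
  have "(p \<cdot> f, q \<cdot> f) \<in> CC T S I \<Delta> t s" if pq: "(p, q) \<in> CC T S I \<Delta> t' s'" for p q
  proof -
    have p: "p \<in> Hom T t' \<Delta>" "q \<in> Hom T t' \<Delta>" and eq: "amap I p \<bullet> s' = amap I q \<bullet> s'"
      using pq by (auto simp: CC_def)
    have "amap I (r \<cdot> f) \<bullet> s = amap I r \<bullet> s' \<bullet> g" if "r \<in> Hom T t' \<Delta>" for r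
      using I_Comp_assoc[OF f that s] Comp_assoc[OF S g'(1) s' functor_Hom[OF I that]] g'(2) by simp
    then show ?thesis
      using p eq Comp_in_Hom[OF T f] by (simp add: CC_def)
  qed
  then show ?thesis
    using Q_ex_iff[OF C_ob[OF Ob(1)] C_ob[OF Ob(2)], of f] f by (auto simp: x y C_ob_def)
qed

text \<open>The factorisation criterion is applied to the subobject itself, which factors through
  itself.\<close>

lemma VV_equalises:
  assumes "(t, R) \<in> Ob Q" and "(p, q) \<in> R"
  shows "amap I p \<bullet> VV S I t R = amap I q \<bullet> VV S I t R"
proof -
  note o = Q_objectsD(1,3)[OF assms(1)]
  note V = Sub_in_Hom[OF VV_Sub[OF o]]
  show ?thesis
    using factors_through_VV_iff[OF o V] factors_through_refl[OF S HomD(1)[OF V]] assms(2) by blast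
qed

text \<open>Precomposition with \<open>f\<close> sends pairs of \<open>R'\<close> into
  \<open>R\<close>, and those are equalised by \<open>VV S I t R\<close>. Hence
  \<open>amap I f \<bullet> VV S I t R\<close> equalises all pairs of \<open>R'\<close> and factors
  through \<open>VV S I t' R'\<close>.\<close>

lemma V_ex:
  assumes \<beta>: "\<beta> \<in> Hom Q y x" and ind: "Q_induces T \<Delta> f \<beta>"
  shows "\<exists>\<alpha>\<in>Hom D (\<V> x) (\<V> y). D_induces T S I f \<alpha>"
proof -
  obtain t R where x: "x = (t, R)" by fastforce
  obtain t' R' where y: "y = (t', R')" by fastforce
  have Ob: "x \<in> Ob Q" "y \<in> Ob Q"
    using \<beta> by (auto simp: Hom_Q)
  note o = Q_objectsD[OF Ob(1)[unfolded x]] and o' = Q_objectsD[OF Ob(2)[unfolded y]]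
  have f: "f \<in> Hom T t t'"
    using Q_induces_Hom[OF \<beta> ind] by (simp add: x y)
  then have R: "\<forall>(p, q)\<in>R'. (p \<cdot> f, q \<cdot> f) \<in> R"
    using Q_ex_iff[OF Ob, of f] \<beta> ind by (auto simp: x y)
  note V = Sub_in_Hom[OF VV_Sub[OF o(1,3)]]
  have "amap I p \<bullet> (amap I f \<bullet> VV S I t R) = amap I q \<bullet> (amap I f \<bullet> VV S I t R)"
    if pq: "(p, q) \<in> R'" for p q
  proof -
    have "p \<in> Hom T t' \<Delta>" "q \<in> Hom T t' \<Delta>"
      using pq o'(3) by blast+
    moreover have "(p \<cdot> f, q \<cdot> f) \<in> R"
      using R pq by blast
    ultimately show ?thesis
      using I_Comp_assoc[OF f _ V] VV_equalises[OF Ob(1)[unfolded x]] by metis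
  qed
  then have "factors_through S (amap I f \<bullet> VV S I t R) (VV S I t' R')"
    using factors_through_VV_iff[OF o'(1,3) Comp_in_Hom[OF S V functor_Hom[OF I f]]] by blast
  then show ?thesis
    using D_ex_iff[OF V_ob[OF Ob(1)] V_ob[OF Ob(2)], of f] f by (simp add: x y V_ob_def)
qed

text \<open>This makes the functor to \<open>D\<close> well defined on arrows. Inducing the same
  \<open>\<beta>\<close> makes \<open>p \<cdot> f\<close> and \<open>p \<cdot> f'\<close>
  \<open>R\<close>-related for every \<open>p\<close>, so no image of a \<open>p\<close> separates
  \<open>amap I f\<close> from \<open>amap I f'\<close> along \<open>VV S I t R\<close>, and
  coseparation applies.\<close>

lemma V_unique:
  assumes \<beta>: "\<beta> \<in> Hom Q y x" and ind: "Q_induces T \<Delta> f \<beta>" "Q_induces T \<Delta> f' \<beta>"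
    and \<alpha>: "\<alpha> \<in> Hom D (\<V> x) (\<V> y)" "\<alpha>' \<in> Hom D (\<V> x) (\<V> y)"
    and ind': "D_induces T S I f \<alpha>" "D_induces T S I f' \<alpha>'"
  shows "\<alpha> = \<alpha>'"
proof -
  obtain t R where x: "x = (t, R)" by fastforce
  obtain t' R' where y: "y = (t', R')" by fastforce
  have Ob: "x \<in> Ob Q" "y \<in> Ob Q"
    using \<beta> by (auto simp: Hom_Q)
  note o = Q_objectsD[OF Ob(1)[unfolded x]] and o' = Q_objectsD[OF Ob(2)[unfolded y]]
  have f: "f \<in> Hom T t t'" "f' \<in> Hom T t t'"
    using Q_induces_Hom[OF \<beta>] ind by (auto simp: x y)
  note V = Sub_in_Hom[OF VV_Sub[OF o(1,3)]]
  have If: "amap I f \<bullet> VV S I t R \<in> Hom S (Dom S (VV S I t R)) (omap I t')"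
      "amap I f' \<bullet> VV S I t R \<in> Hom S (Dom S (VV S I t R)) (omap I t')"
    using Comp_in_Hom[OF S V] functor_Hom[OF I] f by blast+
  have "amap I f \<bullet> VV S I t R = amap I f' \<bullet> VV S I t R"
  proof (rule coseparator_eqI[OF o'(1) If])
    fix p assume p: "p \<in> Hom T t' \<Delta>"
    then have "(p \<cdot> f, p \<cdot> f') \<in> R"
      using Q_eq_iff[OF \<beta> \<beta> ind] by (simp add: x y)
    then show "amap I p \<bullet> (amap I f \<bullet> VV S I t R) = amap I p \<bullet> (amap I f' \<bullet> VV S I t R)"
      using I_Comp_assoc[OF f(1) p V] I_Comp_assoc[OF f(2) p V] VV_equalises[OF Ob(1)[unfolded x]]
      by metis
  qed
  then show ?thesis
    using D_eq_iff[OF \<alpha> ind'] by (simp add: x V_ob_def)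
qed

section \<open>The two functors on arrows\<close>

lemma C_amap_eq:
  assumes \<alpha>: "\<alpha> \<in> Hom D x y" and \<beta>: "\<beta> \<in> Hom Q (\<C> y) (\<C> x)"
    and ind: "D_induces T S I f \<alpha>" "Q_induces T \<Delta> f \<beta>"
  shows "amap (C_functor T S I \<Delta>) \<alpha> = \<beta>"
proof -
  obtain g where g: "\<alpha> = (x, g, y)"
    using \<alpha> by (auto simp: Hom_D)
  obtain h where h: "\<beta> = (\<C> y, h, \<C> x)"
    using \<beta> by (auto simp: Hom_Q)
  have x: "x \<in> Ob D"
    using \<alpha> by (simp add: Hom_D)
  have "(THE h. \<exists>f. D_induces T S I f (x, g, y) \<and> Q_induces T \<Delta> f (\<C> y, h, \<C> x)) = h"
  proof (rule the_equality)
    show "\<exists>f. D_induces T S I f (x, g, y) \<and> Q_induces T \<Delta> f (\<C> y, h, \<C> x)"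
      using ind unfolding g h by blast
    fix h' assume "\<exists>f. D_induces T S I f (x, g, y) \<and> Q_induces T \<Delta> f (\<C> y, h', \<C> x)"
    then obtain f' where f': "D_induces T S I f' \<alpha>" "Q_induces T \<Delta> f' (\<C> y, h', \<C> x)"
      unfolding g by blast
    have "(\<C> y, h', \<C> x) \<in> Hom Q (\<C> y) (\<C> x)"
      using f'(2) \<beta> unfolding Hom_Q by blast
    \<comment> \<open>Two arrows of \<open>T\<close> inducing \<open>\<alpha>\<close> agree along
      \<open>snd x\<close> after applying \<open>I\<close>, and by \<open>Q_CC_eq_iff\<close> they
      then induce the same arrow into \<open>\<C> x\<close>.\<close>
    from Q_CC_eq_iff[OF x this \<beta> f'(2) ind(2)] D_eq_iff[OF \<alpha> \<alpha> f'(1) ind(1)]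
    show "h' = h"
      by (simp add: h)
  qed
  then show ?thesis
    by (simp add: C_functor_def g h)
qed

text \<open>Several arrows of \<open>T\<close> may induce \<open>\<beta>\<close>;
  \<open>V_unique\<close> shows that they all give the same arrow of \<open>D\<close>, so the
  definite description has one solution.\<close>

lemma V_amap_eq:
  assumes \<beta>: "\<beta> \<in> Hom Q y x" and \<alpha>: "\<alpha> \<in> Hom D (\<V> x) (\<V> y)"
    and ind: "Q_induces T \<Delta> f \<beta>" "D_induces T S I f \<alpha>"
  shows "amap (V_functor T S I \<Delta>) \<beta> = \<alpha>"
proof -
  obtain g where g: "\<alpha> = (\<V> x, g, \<V> y)"
    using \<alpha> by (auto simp: Hom_D)
  obtain h where h: "\<beta> = (y, h, x)"
    using \<beta> by (auto simp: Hom_Q)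
  have "(THE g. \<exists>f. Q_induces T \<Delta> f (y, h, x) \<and> D_induces T S I f (\<V> x, g, \<V> y)) = g"
  proof (rule the_equality)
    show "\<exists>f. Q_induces T \<Delta> f (y, h, x) \<and> D_induces T S I f (\<V> x, g, \<V> y)"
      using ind unfolding g h by blast
    fix g' assume "\<exists>f. Q_induces T \<Delta> f (y, h, x) \<and> D_induces T S I f (\<V> x, g', \<V> y)"
    then obtain f' where f': "Q_induces T \<Delta> f' \<beta>" "D_induces T S I f' (\<V> x, g', \<V> y)"
      unfolding h by blast
    have "(\<V> x, g', \<V> y) \<in> Hom D (\<V> x) (\<V> y)"
      using f'(2) \<alpha> unfolding Hom_D by blast
    from V_unique[OF \<beta> f'(1) ind(1) this \<alpha> f'(2) ind(2)] show "g' = g"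
      by (simp add: g)
  qed
  then show ?thesis
    by (simp add: V_functor_def g h)
qed

text \<open>Every arrow inducing \<open>\<alpha>\<close>, not merely a selected one, induces its
  image. This lets one inducing arrow be carried through composites and naturality squares.\<close>

lemma C_amap:
  assumes \<alpha>: "\<alpha> \<in> Hom D x y"
  shows C_amap_Hom: "amap (C_functor T S I \<Delta>) \<alpha> \<in> Hom Q (\<C> y) (\<C> x)"
    and C_amap_induces: "D_induces T S I f \<alpha> \<Longrightarrow> Q_induces T \<Delta> f (amap (C_functor T S I \<Delta>) \<alpha>)"
proof -
  have *: "amap (C_functor T S I \<Delta>) \<alpha> \<in> Hom Q (\<C> y) (\<C> x) \<and> Q_induces T \<Delta> f (amap (C_functor T S I \<Delta>) \<alpha>)"
    if f: "D_induces T S I f \<alpha>" for f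
  proof -
    obtain \<beta> where "\<beta> \<in> Hom Q (\<C> y) (\<C> x)" "Q_induces T \<Delta> f \<beta>"
      using C_ex[OF \<alpha> f] by blast
    then show ?thesis
      using C_amap_eq[OF \<alpha> _ f] by simp
  qed
  then show "amap (C_functor T S I \<Delta>) \<alpha> \<in> Hom Q (\<C> y) (\<C> x)"
    using D_obtain[OF \<alpha>] by blast
  show "D_induces T S I f \<alpha> \<Longrightarrow> Q_induces T \<Delta> f (amap (C_functor T S I \<Delta>) \<alpha>)"
    using * by blast
qed

lemma V_amap:
  assumes \<beta>: "\<beta> \<in> Hom Q y x"
  shows V_amap_Hom: "amap (V_functor T S I \<Delta>) \<beta> \<in> Hom D (\<V> x) (\<V> y)"
    and V_amap_induces: "Q_induces T \<Delta> f \<beta> \<Longrightarrow> D_induces T S I f (amap (V_functor T S I \<Delta>) \<beta>)"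
proof -
  have *: "amap (V_functor T S I \<Delta>) \<beta> \<in> Hom D (\<V> x) (\<V> y) \<and> D_induces T S I f (amap (V_functor T S I \<Delta>) \<beta>)"
    if f: "Q_induces T \<Delta> f \<beta>" for f
  proof -
    obtain \<alpha> where "\<alpha> \<in> Hom D (\<V> x) (\<V> y)" "D_induces T S I f \<alpha>"
      using V_ex[OF \<beta> f] by blast
    then show ?thesis
      using V_amap_eq[OF \<beta> _ f] by simp
  qed
  then show "amap (V_functor T S I \<Delta>) \<beta> \<in> Hom D (\<V> x) (\<V> y)"
    using Q_obtain[OF \<beta>] by blast
  show "Q_induces T \<Delta> f \<beta> \<Longrightarrow> D_induces T S I f (amap (V_functor T S I \<Delta>) \<beta>)"
    using * by blast
qed

lemma C_functor: "is_functor D (opposite Q) (C_functor T S I \<Delta>)"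
proof (rule is_functorI)
  have [simp]: "omap (C_functor T S I \<Delta>) = \<C>"
    by (simp add: C_functor_def)
  fix x assume x: "x \<in> Ob D"
  then show "omap (C_functor T S I \<Delta>) x \<in> Ob (opposite Q)"
    using C_ob by simp
  have "fst (\<C> x) = fst x"
    by (simp add: C_ob_def split: prod.split)
  then show "amap (C_functor T S I \<Delta>) (Id D x) = Id (opposite Q) (omap (C_functor T S I \<Delta>) x)"
    using C_amap_eq[OF D_Id_Hom[OF x] Q_Id_Hom[OF C_ob[OF x]] D_induces_Id[OF x]]
      Q_induces_Id[OF C_ob[OF x]] by simp
next
  fix \<alpha> x y assume "\<alpha> \<in> Hom D x y"
  then show "amap (C_functor T S I \<Delta>) \<alpha> \<in>
      Hom (opposite Q) (omap (C_functor T S I \<Delta>) x) (omap (C_functor T S I \<Delta>) y)"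
    using C_amap_Hom by (simp add: C_functor_def)
next
  fix \<alpha> \<beta> x y z assume \<alpha>: "\<alpha> \<in> Hom D x y" and \<beta>: "\<beta> \<in> Hom D y z"
  obtain f g where f: "D_induces T S I f \<alpha>" and g: "D_induces T S I g \<beta>"
    using D_obtain[OF \<alpha>] D_obtain[OF \<beta>] by metis
  note h = C_amap_Hom[OF \<alpha>] C_amap_Hom[OF \<beta>]
  show "amap (C_functor T S I \<Delta>) (\<beta> \<odot>\<^bsub>D\<^esub> \<alpha>) =
      amap (C_functor T S I \<Delta>) \<beta> \<odot>\<^bsub>opposite Q\<^esub> amap (C_functor T S I \<Delta>) \<alpha>"
    \<comment> \<open>The composite of the images is induced by \<open>g \<cdot> f\<close>, which
      also induces the composite in \<open>D\<close>, so \<open>C_amap_eq\<close> recognises it as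
      the image. Passing to \<open>opposite Q\<close> restores the order of composition.\<close>
    using C_amap_eq[OF D_Comp_Hom[OF \<alpha> \<beta>] Q_Comp_Hom[OF h] D_induces_Comp[OF \<alpha> \<beta> f g]
        Q_induces_Comp[OF h C_amap_induces[OF \<alpha> f] C_amap_induces[OF \<beta> g]]] by simp
qed (simp_all add: category_D category_Q category_opposite)

lemma V_functor: "is_functor (opposite Q) D (V_functor T S I \<Delta>)"
proof (rule is_functorI)
  have [simp]: "omap (V_functor T S I \<Delta>) = \<V>"
    by (simp add: V_functor_def)
  fix x assume "x \<in> Ob (opposite Q)"
  then have x: "x \<in> Ob Q"
    by simp
  then show "omap (V_functor T S I \<Delta>) x \<in> Ob D"
    using V_ob by simp
  have "fst (\<V> x) = fst x"
    by (simp add: V_ob_def split: prod.split)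
  then show "amap (V_functor T S I \<Delta>) (Id (opposite Q) x) = Id D (omap (V_functor T S I \<Delta>) x)"
    using V_amap_eq[OF Q_Id_Hom[OF x] D_Id_Hom[OF V_ob[OF x]] Q_induces_Id[OF x]]
      D_induces_Id[OF V_ob[OF x]] by simp
next
  fix \<beta> x y assume "\<beta> \<in> Hom (opposite Q) x y"
  then show "amap (V_functor T S I \<Delta>) \<beta> \<in>
      Hom D (omap (V_functor T S I \<Delta>) x) (omap (V_functor T S I \<Delta>) y)"
    using V_amap_Hom by (simp add: V_functor_def)
next
  fix \<alpha> \<beta> x y z assume "\<alpha> \<in> Hom (opposite Q) x y" and "\<beta> \<in> Hom (opposite Q) y z"
  then have \<alpha>: "\<alpha> \<in> Hom Q y x" and \<beta>: "\<beta> \<in> Hom Q z y"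
    by simp_all
  obtain f g where f: "Q_induces T \<Delta> f \<alpha>" and g: "Q_induces T \<Delta> g \<beta>"
    using Q_obtain[OF \<alpha>] Q_obtain[OF \<beta>] by metis
  note h = V_amap_Hom[OF \<alpha>] V_amap_Hom[OF \<beta>]
  show "amap (V_functor T S I \<Delta>) (\<beta> \<odot>\<^bsub>opposite Q\<^esub> \<alpha>) =
      amap (V_functor T S I \<Delta>) \<beta> \<odot>\<^bsub>D\<^esub> amap (V_functor T S I \<Delta>) \<alpha>"
    using V_amap_eq[OF Q_Comp_Hom[OF \<alpha> \<beta>] D_Comp_Hom[OF h] Q_induces_Comp[OF \<alpha> \<beta> f g]
        D_induces_Comp[OF h V_amap_induces[OF \<alpha> f] V_amap_induces[OF \<beta> g]]] by simp
qed (simp_all add: category_D category_Q category_opposite)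

section \<open>The transposition bijection and its naturality\<close>

definition adjunct where
  "adjunct x y \<beta> = (THE \<alpha>. \<alpha> \<in> Hom D x (\<V> y) \<and> (\<exists>f. Q_induces T \<Delta> f \<beta> \<and> D_induces T S I f \<alpha>))"

text \<open>Both equalities mean that \<open>f\<close> and \<open>f'\<close> agree along
  \<open>snd x\<close> after applying \<open>I\<close>. Read from left to right this makes
  transposition well defined, from right to left injective.\<close>

lemma adjunct_eq_iff:
  assumes x: "x \<in> Ob D"
    and \<beta>: "\<beta> \<in> Hom Q y (\<C> x)" "\<beta>' \<in> Hom Q y (\<C> x)"
    and \<alpha>: "\<alpha> \<in> Hom D x (\<V> y)" "\<alpha>' \<in> Hom D x (\<V> y)"
    and ind: "Q_induces T \<Delta> f \<beta>" "Q_induces T \<Delta> f' \<beta>'" "D_induces T S I f \<alpha>" "D_induces T S I f' \<alpha>'"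
  shows "\<beta> = \<beta>' \<longleftrightarrow> \<alpha> = \<alpha>'"
  using Q_CC_eq_iff[OF x \<beta> ind(1,2)] D_eq_iff[OF \<alpha> ind(3,4)] by simp

text \<open>The description leaves the inducing arrow open, but by \<open>adjunct_eq_iff\<close> any
  other choice leads to the same result. Transposes are evaluated through this lemma from here
  on.\<close>

lemma adjunct_eq:
  assumes "x \<in> Ob D" and "\<beta> \<in> Hom Q y (\<C> x)" and "\<alpha> \<in> Hom D x (\<V> y)"
    and "Q_induces T \<Delta> f \<beta>" and "D_induces T S I f \<alpha>"
  shows "adjunct x y \<beta> = \<alpha>"
  unfolding adjunct_def
proof (rule the_equality)
  show "\<alpha> \<in> Hom D x (\<V> y) \<and> (\<exists>f. Q_induces T \<Delta> f \<beta> \<and> D_induces T S I f \<alpha>)"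
    using assms by blast
  fix \<alpha>' assume "\<alpha>' \<in> Hom D x (\<V> y) \<and> (\<exists>f. Q_induces T \<Delta> f \<beta> \<and> D_induces T S I f \<alpha>')"
  then obtain f' where \<alpha>': "\<alpha>' \<in> Hom D x (\<V> y)" "Q_induces T \<Delta> f' \<beta>" "D_induces T S I f' \<alpha>'"
    by blast
  show "\<alpha>' = \<alpha>"
    using adjunct_eq_iff[OF assms(1,2,2) \<alpha>'(1) assms(3) \<alpha>'(2) assms(4) \<alpha>'(3) assms(5)] by simp
qed

lemma adjunct:
  assumes x: "x \<in> Ob D" and \<beta>: "\<beta> \<in> Hom Q y (\<C> x)" and f: "Q_induces T \<Delta> f \<beta>"
  shows adjunct_Hom: "adjunct x y \<beta> \<in> Hom D x (\<V> y)"
    and adjunct_induces: "D_induces T S I f (adjunct x y \<beta>)"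
proof -
  have y: "y \<in> Ob Q"
    using \<beta> by (simp add: Hom_Q)
  have "fst (\<C> x) = fst x"
    by (simp add: C_ob_def split: prod.split)
  then have "f \<in> Hom T (fst x) (fst y)"
    using Q_induces_Hom[OF \<beta> f] by simp
  from Q_ex_iff_D_ex[OF x y this] obtain \<alpha> where "\<alpha> \<in> Hom D x (\<V> y)" "D_induces T S I f \<alpha>"
    using \<beta> f by blast
  then show "adjunct x y \<beta> \<in> Hom D x (\<V> y)" "D_induces T S I f (adjunct x y \<beta>)"
    using adjunct_eq[OF x \<beta> _ f] by simp_all
qed

lemma bij_adjunct:
  assumes x: "x \<in> Ob D" and y: "y \<in> Ob Q"
  shows "bij_betw (adjunct x y) (Hom Q y (\<C> x)) (Hom D x (\<V> y))"
  unfolding bij_betw_def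
proof (intro conjI subset_antisym subsetI inj_onI)
  fix \<beta> \<beta>' assume \<beta>: "\<beta> \<in> Hom Q y (\<C> x)" and \<beta>': "\<beta>' \<in> Hom Q y (\<C> x)"
    and eq: "adjunct x y \<beta> = adjunct x y \<beta>'"
  obtain f f' where f: "Q_induces T \<Delta> f \<beta>" and f': "Q_induces T \<Delta> f' \<beta>'"
    using Q_obtain[OF \<beta>] Q_obtain[OF \<beta>'] by metis
  show "\<beta> = \<beta>'"
    using adjunct_eq_iff[OF x \<beta> \<beta>' adjunct_Hom[OF x \<beta> f] adjunct_Hom[OF x \<beta>' f'] f f'
        adjunct_induces[OF x \<beta> f] adjunct_induces[OF x \<beta>' f']] eq by simp
next
  fix \<alpha> assume "\<alpha> \<in> adjunct x y ` Hom Q y (\<C> x)"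
  then obtain \<beta> where \<beta>: "\<beta> \<in> Hom Q y (\<C> x)" "\<alpha> = adjunct x y \<beta>"
    by blast
  obtain f where "Q_induces T \<Delta> f \<beta>"
    using Q_obtain[OF \<beta>(1)] .
  then show "\<alpha> \<in> Hom D x (\<V> y)"
    using adjunct_Hom[OF x \<beta>(1)] \<beta>(2) by simp
next
  fix \<alpha> assume \<alpha>: "\<alpha> \<in> Hom D x (\<V> y)"
  obtain f where f: "D_induces T S I f \<alpha>"
    using D_obtain[OF \<alpha>] .
  have "fst (\<V> y) = fst y"
    by (simp add: V_ob_def split: prod.split)
  then have "f \<in> Hom T (fst x) (fst y)"
    using D_induces_Hom[OF \<alpha> f] by simp
  \<comment> \<open>The arrow of \<open>T\<close> that induces \<open>\<alpha>\<close> also induces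
    an arrow of \<open>Q\<close>, whose transpose is then \<open>\<alpha>\<close>.\<close>
  from Q_ex_iff_D_ex[OF x y this] obtain \<beta> where \<beta>: "\<beta> \<in> Hom Q y (\<C> x)" "Q_induces T \<Delta> f \<beta>"
    using \<alpha> f by blast
  then show "\<alpha> \<in> adjunct x y ` Hom Q y (\<C> x)"
    using adjunct_eq[OF x \<beta>(1) \<alpha> \<beta>(2) f] by blast
qed

text \<open>In \<open>opposite Q\<close> the argument reads \<open>\<gamma>\<close> after
  \<open>\<beta>\<close> after the image of \<open>\<alpha>\<close>; here it is written in
  \<open>Q\<close>, in reverse order. If \<open>f\<close>, \<open>g\<close>, \<open>h\<close> induce
  \<open>\<alpha>\<close>, \<open>\<gamma>\<close>, \<open>\<beta>\<close>, then
  \<open>g \<cdot> h \<cdot> f\<close> induces both the argument on the left and the composite on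
  the right, and \<open>adjunct_eq\<close> makes the latter its transpose.\<close>

lemma adjunct_natural:
  assumes x: "x \<in> Ob D" and x': "x' \<in> Ob D"
    and \<alpha>: "\<alpha> \<in> Hom D x' x" and \<gamma>: "\<gamma> \<in> Hom Q y' y" and \<beta>: "\<beta> \<in> Hom Q y (\<C> x)"
  shows "adjunct x' y' (amap (C_functor T S I \<Delta>) \<alpha> \<odot>\<^bsub>Q\<^esub> (\<beta> \<odot>\<^bsub>Q\<^esub> \<gamma>)) =
    amap (V_functor T S I \<Delta>) \<gamma> \<odot>\<^bsub>D\<^esub> adjunct x y \<beta> \<odot>\<^bsub>D\<^esub> \<alpha>"
proof -
  obtain f g h where f: "D_induces T S I f \<alpha>" and g: "Q_induces T \<Delta> g \<gamma>" and h: "Q_induces T \<Delta> h \<beta>"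
    using D_obtain[OF \<alpha>] Q_obtain[OF \<gamma>] Q_obtain[OF \<beta>] by metis
  note C = C_amap_Hom[OF \<alpha>] and V = V_amap_Hom[OF \<gamma>] and t = adjunct[OF x \<beta> h]
  note \<beta>\<gamma> = Q_Comp_Hom[OF \<beta> \<gamma>] and Vt = D_Comp_Hom[OF t(1) V]
  show ?thesis
    by (rule adjunct_eq[OF x' Q_Comp_Hom[OF C \<beta>\<gamma>] D_Comp_Hom[OF \<alpha> Vt]
        Q_induces_Comp[OF C \<beta>\<gamma> C_amap_induces[OF \<alpha> f] Q_induces_Comp[OF \<beta> \<gamma> h g]]
        D_induces_Comp[OF \<alpha> Vt f D_induces_Comp[OF t(1) V t(2) V_amap_induces[OF \<gamma> g]]]])
qed

lemma adjunction: "left_adjoint D (opposite Q) (C_functor T S I \<Delta>) (V_functor T S I \<Delta>)"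
proof -
  have omap: "omap (C_functor T S I \<Delta>) = \<C>" "omap (V_functor T S I \<Delta>) = \<V>"
    by (simp_all add: C_functor_def V_functor_def)
  show ?thesis
    unfolding left_adjoint_def omap opposite_sel Hom_opposite
    using C_functor V_functor bij_adjunct adjunct_natural by blast
qed

end

theorem theorem2p9:
  fixes T :: "('ot, 'at) cat"
    and S :: "('os, 'as) cat"
    and I :: "('ot, 'at, 'os, 'as) fctr"
    and \<Delta> :: 'ot
  assumes "category T" and "locally_small TYPE('u) T"
    and "category S" and "locally_small TYPE('u) S"
    and "well_powered TYPE('u) S"
    and "is_functor T S I"
    and "\<Delta> \<in> Ob T"
    and "has_equalisers S" and "has_intersections S"
    and "preserves_powers TYPE('u) T S I \<Delta>"
    and "coseparator T S I \<Delta>"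
  shows "left_adjoint (DD T S I) (opposite (QQ TYPE('u) T \<Delta>))
           (C_functor T S I \<Delta>) (V_functor T S I \<Delta>)"
proof -
  interpret coseparated_powers "TYPE('u)" T S I \<Delta>
    using assms by unfold_locales
  show ?thesis
    by (rule adjunction)
qed

end
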